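(* Let $X=(\mathbb{F}_q,\alpha)$ be a quandle of cyclic type, let $V$ be a finite-dimensional complex vector space, and let $\psi:X\to\mathrm{Conj}(\mathrm{Aut}(V))$ be a maximal quandle representation of $X$ of dimension $>1$. Then $\psi$ is a constant map. If $\rho$ is the characteristic polynomial of $\psi(0)$ and $n_z$ is the multiplicity of $z$ as a root of $\rho$, then there is an isomorphism of quandle representations $$V\cong\bigoplus_{\rho(z)=0}U_{J(z,n_z)}.$$ In particular, there are no non-trivial (i.e. of dimension greater than $1$) irreducible maximal representations of $X$.
   Context: A finite quandle $X$ of cardinality $m>2$ is of cyclic type if each right multiplication $y\mapsto y\triangleright i$ is a cycle of length $m-1$; equivalently, $X$ is isomorphic to an Alexander quandle $(\mathbb{F}_q,\alpha)$, i.e. $\mathbb{F}_q$ with operation $x\triangleright y=\alpha x+(1-\alpha)y$, where $\alpha$ is a primitive element (generator of $\mathbb{F}_q^*$) and $q>2$. $\mathrm{Conj}(G)$ is the group $G$ with quandle operation $g\triangleright h=hgh^{-1}$. A representation of $X$ on $V$ is a quandle homomorphism $X\to\mathrm{Conj}(\mathrm{Aut}(V))$; an isomorphism of representations is a linear isomorphism intertwining the actions of all $x\in X$; a subrepresentation is a subspace invariant under all elements of the image; a representation is irreducible if its only subrepresentations are $0$ and itself. $J(\lambda,s)$ is the $s\times s$ Jordan block with eigenvalue $\lambda$ (ones on the superdiagonal). A square complex matrix (or linear operator) with Jordan normal form $J(\lambda_1,s_1)\oplus\cdots\oplus J(\lambda_r,s_r)$ is $k$-th-power maximal if $\lambda_i^k\ne\lambda_j^k$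 for all $i\neq j$ (distinct Jordan blocks). A representation $\psi$ of $X=(\mathbb{F}_q,\alpha)$ is maximal if $\psi(0)$ is $(q-1)$-th-power maximal, where $0\in\mathbb{F}_q$. For an invertible $n\times n$ matrix $M$, $U_M$ denotes the representation of $X$ on $\mathbb{C}^n$ given by the constant map sending every element of $X$ to $M$. *)

theory Defs
  imports
    "HOL-Algebra.Bij"
    "HOL-Algebra.Multiplicative_Group"
    "Jordan_Normal_Form.VS_Connect"
    "Jordan_Normal_Form.Jordan_Normal_Form"
begin

section \<open>Quandles\<close>

record 'a quandle = "'a partial_object" +
  qop :: "'a \<Rightarrow> 'a \<Rightarrow> 'a" (infixl "\<triangleright>\<index>" 70)

text \<open>Right-handed convention: the right multiplications \<open>y \<mapsto> y \<triangleright> x\<close> are automorphisms.\<close>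

locale quandle =
  fixes X (structure)
  assumes qop_closed: "\<lbrakk>x \<in> carrier X; y \<in> carrier X\<rbrakk> \<Longrightarrow> x \<triangleright> y \<in> carrier X"
    and qop_idem: "x \<in> carrier X \<Longrightarrow> x \<triangleright> x = x"
    and qop_bij: "x \<in> carrier X \<Longrightarrow> bij_betw (\<lambda>y. y \<triangleright> x) (carrier X) (carrier X)"
    and qop_dist: "\<lbrakk>x \<in> carrier X; y \<in> carrier X; z \<in> carrier X\<rbrakk>
      \<Longrightarrow> (x \<triangleright> y) \<triangleright> z = (x \<triangleright> z) \<triangleright> (y \<triangleright> z)"

definition quandle_hom :: "('a, 'm) quandle_scheme \<Rightarrow> ('b, 'n) quandle_scheme \<Rightarrow> ('a \<Rightarrow> 'b) set" where
  "quandle_hom X Y = {f \<in> carrier X \<rightarrow> carrier Y.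
     \<forall>x\<in>carrier X. \<forall>y\<in>carrier X. f (x \<triangleright>\<^bsub>X\<^esub> y) = f x \<triangleright>\<^bsub>Y\<^esub> f y}"

definition Conj :: "('a, 'm) monoid_scheme \<Rightarrow> 'a quandle" where
  "Conj G = \<lparr>carrier = carrier G, qop = (\<lambda>g h. h \<otimes>\<^bsub>G\<^esub> g \<otimes>\<^bsub>G\<^esub> inv\<^bsub>G\<^esub> h)\<rparr>"

lemma (in group) quandle_Conj: "quandle (Conj G)"
proof
  fix x y z
  assume "x \<in> carrier (Conj G)" "y \<in> carrier (Conj G)" "z \<in> carrier (Conj G)"
  then have [simp]: "x \<in> carrier G" "y \<in> carrier G" "z \<in> carrier G"
    by (simp_all add: Conj_def)
  have canc: "inv z \<otimes> (z \<otimes> w) = w" if "w \<in> carrier G" for w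
    using that by (simp add: m_assoc [symmetric])
  show "(x \<triangleright>\<^bsub>Conj G\<^esub> y) \<triangleright>\<^bsub>Conj G\<^esub> z
      = (x \<triangleright>\<^bsub>Conj G\<^esub> z) \<triangleright>\<^bsub>Conj G\<^esub> (y \<triangleright>\<^bsub>Conj G\<^esub> z)"
    by (simp add: Conj_def m_assoc inv_mult_group canc)
next
  fix x assume "x \<in> carrier (Conj G)"
  then have [simp]: "x \<in> carrier G" by (simp add: Conj_def)
  have "bij_betw (\<lambda>y. x \<otimes> y \<otimes> inv x) (carrier G) (carrier G)"
  proof (rule bij_betw_byWitness [where f' = "\<lambda>y. inv x \<otimes> y \<otimes> x"])
    show "\<forall>y\<in>carrier G. inv x \<otimes> (x \<otimes> y \<otimes> inv x) \<otimes> x = y"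
      by (metis \<open>x \<in> carrier G\<close> inv_closed inv_solve_left inv_solve_right m_assoc m_closed)
    show "\<forall>y\<in>carrier G. x \<otimes> (inv x \<otimes> y \<otimes> x) \<otimes> inv x = y"
      by (metis \<open>x \<in> carrier G\<close> inv_closed inv_solve_left inv_solve_right m_assoc m_closed)
  qed auto
  then show "bij_betw (\<lambda>y. y \<triangleright>\<^bsub>Conj G\<^esub> x) (carrier (Conj G)) (carrier (Conj G))"
    by (simp add: Conj_def)
qed (auto simp: Conj_def m_assoc)

definition Alexander :: "('a, 'm) ring_scheme \<Rightarrow> 'a \<Rightarrow> 'a quandle" where
  "Alexander F \<alpha> = \<lparr>carrier = carrier F,
     qop = (\<lambda>x y. \<alpha> \<otimes>\<^bsub>F\<^esub> x \<oplus>\<^bsub>F\<^esub> (\<one>\<^bsub>F\<^esub> \<ominus>\<^bsub>F\<^esub> \<alpha>) \<otimes>\<^bsub>F\<^esub> y)\<rparr>"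

lemma (in field) quandle_Alexander:
  assumes "\<alpha> \<in> carrier R" "\<alpha> \<noteq> \<zero>"
  shows "quandle (Alexander R \<alpha>)"
proof
  fix x y z
  assume "x \<in> carrier (Alexander R \<alpha>)" "y \<in> carrier (Alexander R \<alpha>)" "z \<in> carrier (Alexander R \<alpha>)"
  then have "x \<in> carrier R" "y \<in> carrier R" "z \<in> carrier R"
    by (simp_all add: Alexander_def)
  with assms show "(x \<triangleright>\<^bsub>Alexander R \<alpha>\<^esub> y) \<triangleright>\<^bsub>Alexander R \<alpha>\<^esub> z
      = (x \<triangleright>\<^bsub>Alexander R \<alpha>\<^esub> z) \<triangleright>\<^bsub>Alexander R \<alpha>\<^esub> (y \<triangleright>\<^bsub>Alexander R \<alpha>\<^esub> z)"
    by (simp add: Alexander_def) algebra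
next
  fix x assume "x \<in> carrier (Alexander R \<alpha>)"
  then have x: "x \<in> carrier R" by (simp add: Alexander_def)
  with assms show "x \<triangleright>\<^bsub>Alexander R \<alpha>\<^esub> x = x"
    by (simp add: Alexander_def) algebra
  define \<beta> where "\<beta> = inv \<alpha>"
  have \<beta>: "\<beta> \<in> carrier R" "\<alpha> \<otimes> \<beta> = \<one>" "\<beta> \<otimes> \<alpha> = \<one>"
    using assms by (simp_all add: \<beta>_def field_Units)
  define t where "t = (\<one> \<ominus> \<alpha>) \<otimes> x"
  have t: "t \<in> carrier R" using x assms by (simp add: t_def)
  have "bij_betw (\<lambda>y. \<alpha> \<otimes> y \<oplus> t) (carrier R) (carrier R)"
  proof (rule bij_betw_byWitness [where f' = "\<lambda>y. \<beta> \<otimes> (y \<ominus> t)"])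
    show "\<forall>y\<in>carrier R. \<beta> \<otimes> (\<alpha> \<otimes> y \<oplus> t \<ominus> t) = y"
    proof
      fix y assume y: "y \<in> carrier R"
      then have "\<alpha> \<otimes> y \<oplus> t \<ominus> t = \<alpha> \<otimes> y" using t assms by algebra
      then show "\<beta> \<otimes> (\<alpha> \<otimes> y \<oplus> t \<ominus> t) = y"
        using y \<beta> assms by (simp add: m_assoc [symmetric])
    qed
    show "\<forall>y\<in>carrier R. \<alpha> \<otimes> (\<beta> \<otimes> (y \<ominus> t)) \<oplus> t = y"
    proof
      fix y assume y: "y \<in> carrier R"
      then have "\<alpha> \<otimes> (\<beta> \<otimes> (y \<ominus> t)) = y \<ominus> t"
        using t \<beta> assms by (simp add: m_assoc [symmetric])
      moreover have "y \<ominus> t \<oplus> t = y" using t y by algebra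
      ultimately show "\<alpha> \<otimes> (\<beta> \<otimes> (y \<ominus> t)) \<oplus> t = y" by simp
    qed
  qed (use t \<beta> assms in auto)
  then show "bij_betw (\<lambda>y. y \<triangleright>\<^bsub>Alexander R \<alpha>\<^esub> x) (carrier (Alexander R \<alpha>)) (carrier (Alexander R \<alpha>))"
    by (simp add: Alexander_def t_def)
qed (use assms in \<open>auto simp: Alexander_def\<close>)

definition primitive_element :: "('a, 'm) ring_scheme \<Rightarrow> 'a \<Rightarrow> bool" where
  "primitive_element F \<alpha> \<longleftrightarrow>
     \<alpha> \<in> carrier (mult_of F) \<and> generate (mult_of F) {\<alpha>} = carrier (mult_of F)"

section \<open>Representations of quandles on complex vector spaces\<close>

text \<open>
  A complex vector space is a \<^term>\<open>V\<close> with \<^prop>\<open>vectorspace class_ring V\<close>, where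
  \<^const>\<open>class_ring\<close> is the type \<^typ>\<open>complex\<close> viewed as a ring with carrier.
\<close>

text \<open>As in \<^const>\<open>AutoGroup\<close>, automorphisms are extensional functions on the carrier.\<close>

definition Aut :: "(complex, 'v, 'm) module_scheme \<Rightarrow> ('v \<Rightarrow> 'v) monoid" where
  "Aut V = BijGroup (carrier V) \<lparr>carrier := module_hom class_ring V V \<inter> Bij (carrier V)\<rparr>"

lemma group_Aut:
  assumes "vectorspace class_ring V"
  shows "group (Aut V)"
proof -
  interpret vectorspace class_ring V by fact
  have "subgroup (module_hom class_ring V V \<inter> Bij (carrier V)) (BijGroup (carrier V))"
  proof (rule subgroup.intro)
    fix f g
    assume f: "f \<in> module_hom class_ring V V \<inter> Bij (carrier V)"
      and g: "g \<in> module_hom class_ring V V \<inter> Bij (carrier V)"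
    show "f \<otimes>\<^bsub>BijGroup (carrier V)\<^esub> g \<in> module_hom class_ring V V \<inter> Bij (carrier V)"
      using f g compose_Bij [of f "carrier V" g]
      by (auto simp: BijGroup_def module_hom_def compose_def Pi_iff)
  next
    fix f assume f: "f \<in> module_hom class_ring V V \<inter> Bij (carrier V)"
    then have b: "bij_betw f (carrier V) (carrier V)" by (simp add: Bij_def)
    let ?g = "inv_into (carrier V) f"
    have g: "?g v \<in> carrier V" "f (?g v) = v" if "v \<in> carrier V" for v
      using b that by (auto simp: bij_betw_def inv_into_into f_inv_into_f)
    have gf: "?g (f v) = v" if "v \<in> carrier V" for v
      using b that by (simp add: bij_betw_def inv_into_f_f)
    have "?g (v \<oplus>\<^bsub>V\<^esub> w) = ?g v \<oplus>\<^bsub>V\<^esub> ?g w" if "v \<in> carrier V" "w \<in> carrier V" for v w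
    proof -
      have "f (?g v \<oplus>\<^bsub>V\<^esub> ?g w) = v \<oplus>\<^bsub>V\<^esub> w"
        using f g that by (auto simp: module_hom_def)
      with gf [of "?g v \<oplus>\<^bsub>V\<^esub> ?g w"] g that show ?thesis by auto
    qed
    moreover have "?g (c \<odot>\<^bsub>V\<^esub> v) = c \<odot>\<^bsub>V\<^esub> ?g v" if "v \<in> carrier V" for c v
    proof -
      have "f (c \<odot>\<^bsub>V\<^esub> ?g v) = c \<odot>\<^bsub>V\<^esub> v"
        using f g that by (auto simp: module_hom_def)
      with gf [of "c \<odot>\<^bsub>V\<^esub> ?g v"] g that show ?thesis by auto
    qed
    ultimately show "inv\<^bsub>BijGroup (carrier V)\<^esub> f \<in> module_hom class_ring V V \<inter> Bij (carrier V)"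
      using f g by (auto simp: inv_BijGroup restrict_inv_into_Bij module_hom_def)
  qed (auto simp: BijGroup_def module_hom_def id_Bij)
  then show ?thesis
    by (simp add: Aut_def subgroup.subgroup_is_group group_BijGroup)
qed

definition quandle_rep ::
  "('a, 'm) quandle_scheme \<Rightarrow> (complex, 'v, 'n) module_scheme \<Rightarrow> ('a \<Rightarrow> 'v \<Rightarrow> 'v) \<Rightarrow> bool" where
  "quandle_rep X V \<psi> \<longleftrightarrow> vectorspace class_ring V \<and> \<psi> \<in> quandle_hom X (Conj (Aut V))"

definition rep_isomorphic ::
  "('a, 'm) quandle_scheme \<Rightarrow> (complex, 'v, 'n) module_scheme \<Rightarrow> ('a \<Rightarrow> 'v \<Rightarrow> 'v)
    \<Rightarrow> (complex, 'w, 'k) module_scheme \<Rightarrow> ('a \<Rightarrow> 'w \<Rightarrow> 'w) \<Rightarrow> bool" where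
  "rep_isomorphic X V \<psi> W \<phi> \<longleftrightarrow> quandle_rep X V \<psi> \<and> quandle_rep X W \<phi> \<and>
     (\<exists>T \<in> module_hom class_ring V W. bij_betw T (carrier V) (carrier W) \<and>
        (\<forall>x\<in>carrier X. \<forall>v\<in>carrier V. T (\<psi> x v) = \<phi> x (T v)))"

definition subrep ::
  "('a, 'm) quandle_scheme \<Rightarrow> (complex, 'v, 'n) module_scheme \<Rightarrow> ('a \<Rightarrow> 'v \<Rightarrow> 'v) \<Rightarrow> 'v set \<Rightarrow> bool" where
  "subrep X V \<psi> W \<longleftrightarrow> subspace class_ring W V \<and> (\<forall>x\<in>carrier X. \<psi> x ` W \<subseteq> W)"

definition irreducible_rep ::
  "('a, 'm) quandle_scheme \<Rightarrow> (complex, 'v, 'n) module_scheme \<Rightarrow> ('a \<Rightarrow> 'v \<Rightarrow> 'v) \<Rightarrow> bool" where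
  "irreducible_rep X V \<psi> \<longleftrightarrow> quandle_rep X V \<psi> \<and>
     (\<forall>W. subrep X V \<psi> W \<longrightarrow> W = {\<zero>\<^bsub>V\<^esub>} \<or> W = carrier V)"

section \<open>Matrices of linear operators\<close>

text \<open>\<open>A\<close> is the matrix of the operator \<open>T\<close> in the ordered basis \<open>bs\<close>.\<close>

definition operator_matrix ::
  "(complex, 'v, 'm) module_scheme \<Rightarrow> 'v list \<Rightarrow> ('v \<Rightarrow> 'v) \<Rightarrow> complex mat \<Rightarrow> bool" where
  "operator_matrix V bs T A \<longleftrightarrow>
     distinct bs \<and> vectorspace.basis class_ring V (set bs) \<and>
     A \<in> carrier_mat (length bs) (length bs) \<and>
     (\<forall>j<length bs. T (bs ! j) = (\<Oplus>\<^bsub>V\<^esub>i\<in>{..<length bs}. A $$ (i, j) \<odot>\<^bsub>V\<^esub> bs ! i))"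

text \<open>For a linear operator the choice is irrelevant: matrices in different bases are similar.\<close>

definition operator_char_poly ::
  "(complex, 'v, 'm) module_scheme \<Rightarrow> ('v \<Rightarrow> 'v) \<Rightarrow> complex poly" where
  "operator_char_poly V T = char_poly (SOME A. \<exists>bs. operator_matrix V bs T A)"

text \<open>
  The list \<open>n_as\<close> in \<^term>\<open>jordan_nf A n_as\<close> consists of the pairs (size, eigenvalue) of the
  Jordan blocks of \<open>A\<close>, and is unique up to order.
\<close>

definition power_maximal :: "nat \<Rightarrow> complex mat \<Rightarrow> bool" where
  "power_maximal k A \<longleftrightarrow> (\<exists>n_as. jordan_nf A n_as \<and>
     (\<forall>i<length n_as. \<forall>j<length n_as. i \<noteq> j \<longrightarrow> snd (n_as ! i) ^ k \<noteq> snd (n_as ! j) ^ k))"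

definition operator_power_maximal ::
  "nat \<Rightarrow> (complex, 'v, 'm) module_scheme \<Rightarrow> ('v \<Rightarrow> 'v) \<Rightarrow> bool" where
  "operator_power_maximal k V T \<longleftrightarrow> (\<exists>bs A. operator_matrix V bs T A \<and> power_maximal k A)"

text \<open>Maximality of a representation \<open>\<psi>\<close> of the Alexander quandle of a finite field \<open>F\<close>.\<close>

definition maximal_rep ::
  "('a, 'm) ring_scheme \<Rightarrow> (complex, 'v, 'n) module_scheme \<Rightarrow> ('a \<Rightarrow> 'v \<Rightarrow> 'v) \<Rightarrow> bool" where
  "maximal_rep F V \<psi> \<longleftrightarrow> operator_power_maximal (card (carrier F) - 1) V (\<psi> \<zero>\<^bsub>F\<^esub>)"

section \<open>Constant representations and direct sums\<close>

text \<open>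
  For an invertible \<open>n\<times>n\<close> matrix \<open>M\<close>, the representation \<open>U\<^sub>M\<close> has underlying space
  \<open>U_space M\<close> (column vectors of length \<open>n\<close>) and action \<open>U_rep M\<close>.
\<close>

definition U_space :: "complex mat \<Rightarrow> (complex, complex vec) module" where
  "U_space M = module_vec TYPE(complex) (dim_row M)"

definition U_rep :: "complex mat \<Rightarrow> 'a \<Rightarrow> complex vec \<Rightarrow> complex vec" where
  "U_rep M x = (\<lambda>v \<in> carrier (U_space M). M *\<^sub>v v)"

text \<open>The fields \<^const>\<open>monoid.mult\<close> and \<^const>\<open>one\<close> of a module record carry no meaning.\<close>

definition dsum_space ::
  "'i set \<Rightarrow> ('i \<Rightarrow> (complex, 'v, 'm) module_scheme) \<Rightarrow> (complex, 'i \<Rightarrow> 'v) module" where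
  "dsum_space I V = \<lparr>
     carrier = {f \<in> (\<Pi>\<^sub>E i\<in>I. carrier (V i)). finite {i \<in> I. f i \<noteq> \<zero>\<^bsub>V i\<^esub>}},
     monoid.mult = undefined,
     one = undefined,
     zero = (\<lambda>i\<in>I. \<zero>\<^bsub>V i\<^esub>),
     add = (\<lambda>f g. \<lambda>i\<in>I. f i \<oplus>\<^bsub>V i\<^esub> g i),
     module.smult = (\<lambda>c f. \<lambda>i\<in>I. c \<odot>\<^bsub>V i\<^esub> f i)\<rparr>"

definition dsum_rep ::
  "'i set \<Rightarrow> ('i \<Rightarrow> (complex, 'v, 'm) module_scheme) \<Rightarrow> ('i \<Rightarrow> 'a \<Rightarrow> 'v \<Rightarrow> 'v)
    \<Rightarrow> 'a \<Rightarrow> ('i \<Rightarrow> 'v) \<Rightarrow> ('i \<Rightarrow> 'v)" where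
  "dsum_rep I V \<psi> x = (\<lambda>f \<in> carrier (dsum_space I V). \<lambda>i\<in>I. \<psi> i x (f i))"

end

theory Submission
  imports Defs
begin

text \<open>
  Write \<open>k = q - 1\<close> and \<open>A\<^sub>x = \<psi> x\<close>. Since \<open>x \<triangleright> 0 = \<alpha>x\<close>, we have \<open>A\<^sub>0 A\<^sub>x = A\<^bsub>\<alpha>x\<^esub> A\<^sub>0\<close>, so the
  sequence \<open>B\<^sub>t = A\<^sub>x\<close> taken at \<open>\<alpha>\<^sup>t x\<close> is \<open>k\<close>-periodic. For a \<open>k\<close>-th root of unity \<open>\<zeta>\<close>, the
  Fourier coefficient \<open>\<Sum>\<^sub>t \<zeta>\<^sup>t B\<^sub>t\<close> intertwines \<open>A\<^sub>0\<close> with \<open>\<zeta>A\<^sub>0\<close>. Maximality says that \<open>A\<^sub>0\<close> and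
  \<open>\<zeta>A\<^sub>0\<close> have no common eigenvalue unless \<open>\<zeta> = 1\<close>, so only the coefficient at \<open>\<zeta> = 1\<close> survives,
  and \<open>B\<^sub>t\<close> is constant. As \<open>\<alpha>\<close> is primitive, \<open>\<psi>\<close> is constant on the nonzero elements, with a
  value that commutes with \<open>A\<^sub>0\<close>; then \<open>0 \<triangleright> 1 = 1 - \<alpha> \<noteq> 0\<close> gives \<open>A\<^sub>1 = A\<^sub>0\<close>.
  The decomposition is the Jordan normal form of \<open>A\<^sub>0\<close>, whose blocks have distinct eigenvalues.
\<close>

section \<open>Intertwiners of a triangular matrix\<close>

text \<open>The uniqueness half of Sylvester's theorem: \<open>X\<close> intertwines
  \<open>J\<close> with \<open>\<zeta>\<close> times \<open>J\<close>, and \<open>ne\<close> says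
  that these two have no common eigenvalue, as the eigenvalues of a triangular matrix stand on its
  diagonal.\<close>

lemma upper_triangular_intertwiner_zero:
  fixes J X :: "'a :: field mat"
  assumes J: "J \<in> carrier_mat n n" and ut: "upper_triangular J" and X: "X \<in> carrier_mat n n"
    and eq: "X * J = \<zeta> \<cdot>\<^sub>m (J * X)"
    and ne: "\<And>i j. i < n \<Longrightarrow> j < n \<Longrightarrow> J $$ (j, j) \<noteq> \<zeta> * J $$ (i, i)"
  shows "X = 0\<^sub>m n n"
proof -
  \<comment> \<open>Column by column from the left, and within a column from the bottom up, each entry satisfies
    \<open>(J\<^sub>j\<^sub>j - \<zeta> J\<^sub>i\<^sub>i) X\<^sub>i\<^sub>j = 0\<close>.\<close>
  have "X $$ (i, j) = 0" if "i < n" "j < n" for i j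
    using that
  \<comment> \<open>The measure drops on moving left in a row or down in a column. Triangularity of
    \<open>J\<close> leaves only such entries, besides the diagonal term, in the two
    products.\<close>
  proof (induction "j + (n - i)" arbitrary: i j rule: less_induct)
    case less
    have "(X * J) $$ (i, j) = (\<Sum>m\<in>{0..<n}. X $$ (i, m) * J $$ (m, j))"
      using J X less.prems by (simp add: scalar_prod_def)
    also have "\<dots> = (\<Sum>m\<in>{0..<n}. if m = j then X $$ (i, j) * J $$ (j, j) else 0)"
    proof (rule sum.cong)
      fix m assume "m \<in> {0..<n}"
      then show "X $$ (i, m) * J $$ (m, j) = (if m = j then X $$ (i, j) * J $$ (j, j) else 0)"
        using less.hyps[of m i] less.prems J upper_triangularD[OF ut, of j m]
        by (cases m j rule: linorder_cases) auto
    qed simp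
    finally have 1: "(X * J) $$ (i, j) = X $$ (i, j) * J $$ (j, j)"
      using less.prems by simp
    have "(J * X) $$ (i, j) = (\<Sum>m\<in>{0..<n}. J $$ (i, m) * X $$ (m, j))"
      using J X less.prems by (simp add: scalar_prod_def)
    also have "\<dots> = (\<Sum>m\<in>{0..<n}. if m = i then J $$ (i, i) * X $$ (i, j) else 0)"
    proof (rule sum.cong)
      fix m assume "m \<in> {0..<n}"
      then show "J $$ (i, m) * X $$ (m, j) = (if m = i then J $$ (i, i) * X $$ (i, j) else 0)"
        using less.hyps[of j m] less.prems J upper_triangularD[OF ut, of m i]
        by (cases m i rule: linorder_cases) auto
    qed simp
    finally have 2: "(J * X) $$ (i, j) = J $$ (i, i) * X $$ (i, j)"
      using less.prems by simp
    have "X $$ (i, j) * J $$ (j, j) = \<zeta> * (J $$ (i, i) * X $$ (i, j))"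
      using arg_cong[OF eq, of "\<lambda>M. M $$ (i, j)"] less.prems J X
      by (simp add: 1 2 del: index_mult_mat(1))
    then have "(J $$ (j, j) - \<zeta> * J $$ (i, i)) * X $$ (i, j) = 0"
      by (simp add: algebra_simps)
    with ne[OF less.prems] show ?case by simp
  qed
  with X show ?thesis by (intro eq_matI) auto
qed

section \<open>Fourier coefficients of a periodic sequence of conjugates\<close>

lemma ex_primitive_root_of_unity:
  assumes "k > 0"
  obtains \<eta> :: complex where "\<eta> ^ k = 1" "\<And>j. 0 < j \<Longrightarrow> j < k \<Longrightarrow> \<eta> ^ j \<noteq> 1"
proof
  let ?f = "\<lambda>j. cis (2 * pi * real j / real k)" and ?\<eta> = "cis (2 * pi / real k)"
  have f: "?\<eta> ^ j = ?f j" for j by (simp add: DeMoivre mult_ac)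
  show "?\<eta> ^ k = 1" using assms by (simp add: f)
  have "inj_on ?f {..<k}" using bij_betw_roots_unity[OF assms] by (simp add: bij_betw_def)
  then show "?\<eta> ^ j \<noteq> 1" if "0 < j" "j < k" for j
    using that assms unfolding f by (auto dest: inj_onD[of _ _ j 0])
qed

lemma sum_lessThan_cyclic_shift:
  fixes g :: "nat \<Rightarrow> 'a :: ab_group_add"
  assumes "g k = g 0"
  shows "(\<Sum>j<k. g (Suc j)) = (\<Sum>j<k. g j)"
proof -
  have "g 0 + (\<Sum>j<k. g (Suc j)) = (\<Sum>j<k. g j) + g k"
    by (metis sum.lessThan_Suc sum.lessThan_Suc_shift)
  with assms show ?thesis by (simp add: add.commute)
qed

text \<open>Fourier inversion at index 0: the coefficients \<open>X r\<close> with
  \<open>r < k\<close> add up to \<open>k\<close> times \<open>B 0\<close>, while all of them except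
  \<open>X 0\<close>, the plain sum of the \<open>B j\<close>, vanish as intertwiners between
  disjoint spectra.\<close>

lemma periodic_conjugates_eq_average:
  fixes J :: "complex mat" and B :: "nat \<Rightarrow> complex mat"
  assumes J: "J \<in> carrier_mat n n" and ut: "upper_triangular J"
    and B: "\<And>t. B t \<in> carrier_mat n n"
    and conj: "\<And>t. J * B t = B (Suc t) * J"
    and k: "k > 0" and per: "B k = B 0"
    and ne: "\<And>\<zeta> i j. \<lbrakk>\<zeta> ^ k = 1; \<zeta> \<noteq> 1; i < n; j < n\<rbrakk> \<Longrightarrow> J $$ (j, j) \<noteq> \<zeta> * J $$ (i, i)"
    and il: "i < n" "l < n"
  shows "of_nat k * B 0 $$ (i, l) = (\<Sum>j<k. B j $$ (i, l))"
proof -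
  obtain \<eta> :: complex where \<eta>: "\<eta> ^ k = 1" "\<And>j. 0 < j \<Longrightarrow> j < k \<Longrightarrow> \<eta> ^ j \<noteq> 1"
    using ex_primitive_root_of_unity[OF k] by blast
  have dims [simp]: "dim_row (B t) = n" "dim_col (B t) = n" for t using B[of t] by auto
  define X where "X r = mat n n (\<lambda>(i, l). \<Sum>j<k. \<eta> ^ (r * j) * B j $$ (i, l))" for r
  have X: "X r \<in> carrier_mat n n" and [simp]: "dim_row (X r) = n" "dim_col (X r) = n" for r
    by (simp_all add: X_def)
  have XJ: "X r * J = \<eta> ^ r \<cdot>\<^sub>m (J * X r)" for r
  proof (rule eq_matI)
    fix a c assume "a < dim_row (\<eta> ^ r \<cdot>\<^sub>m (J * X r))" "c < dim_col (\<eta> ^ r \<cdot>\<^sub>m (J * X r))"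
    then have ac: "a < n" "c < n" using J X[of r] by auto
    have "(\<eta> ^ r \<cdot>\<^sub>m (J * X r)) $$ (a, c)
        = \<eta> ^ r * (\<Sum>m\<in>{0..<n}. J $$ (a, m) * (\<Sum>j<k. \<eta> ^ (r * j) * B j $$ (m, c)))"
      using J X[of r] ac by (simp add: scalar_prod_def) (simp add: X_def)
    also have "\<dots> = (\<Sum>j<k. \<eta> ^ (r * Suc j) * (\<Sum>m\<in>{0..<n}. J $$ (a, m) * B j $$ (m, c)))"
      by (simp add: sum_distrib_left power_add mult_ac) (rule sum.swap)
    also have "\<dots> = (\<Sum>j<k. \<eta> ^ (r * Suc j) * (B (Suc j) * J) $$ (a, c))"
      using J B ac by (simp flip: conj) (simp add: scalar_prod_def)
    \<comment> \<open>The cyclic shift is legitimate because the terms at \<open>k\<close> and at 0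
      agree: \<open>\<eta> ^ k = 1\<close> and \<open>B k = B 0\<close>.\<close>
    also have "\<dots> = (\<Sum>j<k. \<eta> ^ (r * j) * (B j * J) $$ (a, c))"
      by (rule sum_lessThan_cyclic_shift[where g = "\<lambda>j. \<eta> ^ (r * j) * (B j * J) $$ (a, c)"])
        (metis \<eta>(1) mult.commute mult_0_right per power_0 power_mult power_one)
    also have "\<dots> = (\<Sum>j<k. \<eta> ^ (r * j) * (\<Sum>m\<in>{0..<n}. B j $$ (a, m) * J $$ (m, c)))"
      using J B ac by (simp add: scalar_prod_def)
    also have "\<dots> = (\<Sum>m\<in>{0..<n}. (\<Sum>j<k. \<eta> ^ (r * j) * B j $$ (a, m)) * J $$ (m, c))"
      by (simp add: sum_distrib_left sum_distrib_right mult_ac) (rule sum.swap)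
    also have "\<dots> = (X r * J) $$ (a, c)"
      using J X[of r] ac by (simp add: scalar_prod_def) (simp add: X_def)
    finally show "(X r * J) $$ (a, c) = (\<eta> ^ r \<cdot>\<^sub>m (J * X r)) $$ (a, c)" by simp
  qed (use J in auto)
  \<comment> \<open>The factor \<open>\<eta> ^ r\<close> is a \<open>k\<close>-th root of unity,
    different from 1 by primitivity of \<open>\<eta>\<close>, so \<open>ne\<close> applies to
    it.\<close>
  have zero: "X r = 0\<^sub>m n n" if "0 < r" "r < k" for r
    using \<eta> that by (intro upper_triangular_intertwiner_zero[OF J ut X XJ] ne)
      (auto simp flip: power_mult simp: mult.commute[of r] power_mult)
  \<comment> \<open>Orthogonality of characters: for \<open>j\<close> nonzero this is a geometric
    sum whose ratio \<open>\<eta> ^ j\<close> is not 1 but has \<open>k\<close>-th power 1.\<close>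
  have filter: "(\<Sum>r<k. \<eta> ^ (r * j)) = (if j = 0 then of_nat k else 0)" if "j < k" for j
  proof -
    have "(\<eta> ^ j) ^ k = 1" using \<eta>(1) by (metis mult.commute power_mult power_one)
    then show ?thesis using \<eta>(2)[of j] that
      by (cases "j = 0") (simp_all add: mult.commute[of _ j] power_mult sum_gp_strict)
  qed
  have "of_nat k * B 0 $$ (i, l) = (\<Sum>j<k. (\<Sum>r<k. \<eta> ^ (r * j)) * B j $$ (i, l))"
    using k by (simp add: filter if_distrib[of "\<lambda>x. x * _"] sum.delta cong: if_cong)
  also have "\<dots> = (\<Sum>r<k. X r $$ (i, l))"
    using il by (simp add: X_def sum_distrib_right) (rule sum.swap)
  also have "\<dots> = (\<Sum>r<k. if r = 0 then X 0 $$ (i, l) else 0)"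
    by (rule sum.cong) (use zero il in auto)
  also have "\<dots> = (\<Sum>j<k. B j $$ (i, l))"
    using k il by (simp add: X_def)
  finally show ?thesis .
qed

text \<open>The shifted sequence satisfies the same hypotheses, so \<open>B 1\<close> too is the
  average of a full period, and the averages over two full periods coincide.\<close>

lemma periodic_conjugates_constant:
  fixes J :: "complex mat" and B :: "nat \<Rightarrow> complex mat"
  assumes J: "J \<in> carrier_mat n n" "upper_triangular J"
    and B: "\<And>t. B t \<in> carrier_mat n n"
    and conj: "\<And>t. J * B t = B (Suc t) * J"
    and k: "k > 0" and per: "\<And>t. B (t + k) = B t"
    and ne: "\<And>\<zeta> i j. \<lbrakk>\<zeta> ^ k = 1; \<zeta> \<noteq> 1; i < n; j < n\<rbrakk> \<Longrightarrow> J $$ (j, j) \<noteq> \<zeta> * J $$ (i, i)"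
  shows "B 1 = B 0"
proof (rule eq_matI)
  fix i l assume "i < dim_row (B 0)" "l < dim_col (B 0)"
  then have il: "i < n" "l < n" using B[of 0] by auto
  have "of_nat k * B 0 $$ (i, l) = (\<Sum>j<k. B j $$ (i, l))"
    using per[of 0] by (intro periodic_conjugates_eq_average[of J n B, OF J B conj k _ ne il]) auto
  also have "\<dots> = (\<Sum>j<k. B (Suc j) $$ (i, l))"
    using per[of 0] by (intro sum_lessThan_cyclic_shift[symmetric]) simp
  also have "\<dots> = of_nat k * B 1 $$ (i, l)"
    using periodic_conjugates_eq_average[of J n "\<lambda>t. B (Suc t)", OF J B conj k _ ne il] per[of 1]
    by simp
  finally show "B 1 $$ (i, l) = B 0 $$ (i, l)" using k by simp
qed (use B[of 0] B[of 1] in auto)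

text \<open>Turns maximality, a condition on the list of eigenvalues, into a condition on the
  diagonal entries of the triangular matrix.\<close>

lemma jordan_matrix_diag_in:
  "i < sum_list (map fst n_as) \<Longrightarrow> jordan_matrix n_as $$ (i, i) \<in> snd ` set n_as"
proof (induction n_as arbitrary: i)
  case (Cons na n_as)
  obtain s a where na: "na = (s, a)" by force
  show ?case
  proof (cases "i < s")
    case True
    then show ?thesis using Cons.prems by (simp add: na jordan_matrix_Cons)
  next
    case False
    then have "i - s < sum_list (map fst n_as)" using Cons.prems by (simp add: na)
    from Cons.IH[OF this] False Cons.prems show ?thesis by (simp add: na jordan_matrix_Cons)
  qed
qed simp

section \<open>Coordinates\<close>

lemma mult_mat_unit_vec:
  fixes A :: "'a :: semiring_1 mat"
  shows "A \<in> carrier_mat nr n \<Longrightarrow> i < n \<Longrightarrow> A *\<^sub>v unit_vec n i = col A i"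
  by (intro eq_vecI) auto

lemma mat_eqI_mult_vec:
  fixes A B :: "'a :: semiring_1 mat"
  assumes "A \<in> carrier_mat nr n" "B \<in> carrier_mat nr n"
    and "\<And>v. v \<in> carrier_vec n \<Longrightarrow> A *\<^sub>v v = B *\<^sub>v v"
  shows "A = B"
proof (rule mat_col_eqI)
  fix i assume "i < dim_col B"
  then show "col A i = col B i"
    using assms mult_mat_unit_vec[of A nr n i] mult_mat_unit_vec[of B nr n i] by auto
qed (use assms in auto)

abbreviation cvec :: "nat \<Rightarrow> (complex, complex vec) module" where
  "cvec n \<equiv> module_vec TYPE(complex) n"

lemma module_hom_classI:
  fixes V :: "(complex, 'v, 'm) module_scheme" and W :: "(complex, 'w, 'n) module_scheme"
  assumes "\<And>v. v \<in> carrier V \<Longrightarrow> f v \<in> carrier W"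
    and "\<And>v w. \<lbrakk>v \<in> carrier V; w \<in> carrier V\<rbrakk> \<Longrightarrow> f (v \<oplus>\<^bsub>V\<^esub> w) = f v \<oplus>\<^bsub>W\<^esub> f w"
    and "\<And>c v. v \<in> carrier V \<Longrightarrow> f (c \<odot>\<^bsub>V\<^esub> v) = c \<odot>\<^bsub>W\<^esub> f v"
  shows "f \<in> module_hom class_ring V W"
  using assms by (auto simp: module_hom_def)

lemma module_hom_classD:
  fixes V :: "(complex, 'v, 'm) module_scheme" and W :: "(complex, 'w, 'n) module_scheme"
  assumes "f \<in> module_hom class_ring V W"
  shows "v \<in> carrier V \<Longrightarrow> f v \<in> carrier W"
    and "\<lbrakk>v \<in> carrier V; w \<in> carrier V\<rbrakk> \<Longrightarrow> f (v \<oplus>\<^bsub>V\<^esub> w) = f v \<oplus>\<^bsub>W\<^esub> f w"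
    and "v \<in> carrier V \<Longrightarrow> f (c \<odot>\<^bsub>V\<^esub> v) = c \<odot>\<^bsub>W\<^esub> f v"
  using assms by (auto simp: module_hom_def)

lemma module_hom_class_comp:
  fixes U :: "(complex, 'u, 'l) module_scheme"
    and V :: "(complex, 'v, 'm) module_scheme" and W :: "(complex, 'w, 'n) module_scheme"
  assumes "f \<in> module_hom class_ring U V" "g \<in> module_hom class_ring V W"
  shows "(\<lambda>u. g (f u)) \<in> module_hom class_ring U W"
  using module_hom_classD[OF assms(1)] module_hom_classD[OF assms(2)] by (intro module_hom_classI) auto

lemma module_hom_class_inv_into:
  fixes V :: "(complex, 'v, 'm) module_scheme" and W :: "(complex, 'w, 'n) module_scheme"
  assumes V: "vectorspace class_ring V"
    and f: "f \<in> module_hom class_ring V W" "bij_betw f (carrier V) (carrier W)"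
  shows "inv_into (carrier V) f \<in> module_hom class_ring W V"
proof -
  interpret vectorspace class_ring V by fact
  note fD = module_hom_classD[OF f(1)]
  let ?g = "inv_into (carrier V) f"
  have g: "?g w \<in> carrier V" "f (?g w) = w" if "w \<in> carrier W" for w
    using f(2) that by (auto simp: bij_betw_def inv_into_into f_inv_into_f)
  have gf: "?g w = v" if "v \<in> carrier V" "f v = w" for v w
    using f(2) that by (auto simp: bij_betw_def inv_into_f_f)
  show ?thesis
  proof (rule module_hom_classI)
    fix v w assume "v \<in> carrier W" "w \<in> carrier W"
    then show "?g (v \<oplus>\<^bsub>W\<^esub> w) = ?g v \<oplus>\<^bsub>V\<^esub> ?g w" by (intro gf) (auto simp: g fD)
  next
    fix c v assume "v \<in> carrier W"
    then show "?g (c \<odot>\<^bsub>W\<^esub> v) = c \<odot>\<^bsub>V\<^esub> ?g v" by (intro gf) (auto simp: g fD)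
  qed (rule g)
qed

lemma module_hom_cvec_eqI:
  fixes W :: "(complex, 'w, 'm) module_scheme"
  assumes W: "vectorspace class_ring W"
    and f: "f \<in> module_hom class_ring (cvec n) W" and g: "g \<in> module_hom class_ring (cvec n) W"
    and eq: "\<And>i. i < n \<Longrightarrow> f (unit_vec n i) = g (unit_vec n i)"
    and v: "v \<in> carrier_vec n"
  shows "f v = g v"
proof -
  interpret vectorspace class_ring W by fact
  note fD = module_hom_classD[OF f, unfolded module_vec_simps]
  note gD = module_hom_classD[OF g, unfolded module_vec_simps]
  \<comment> \<open>Truncation of \<open>v\<close> to its first \<open>k\<close> coordinates. Each
    step adds one multiple of a unit vector, so additivity and homogeneity suffice for the
    induction.\<close>
  define t where "t k = vec n (\<lambda>i. if i < k then v $ i else 0)" for k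
  have t: "t k \<in> carrier_vec n" for k by (simp add: t_def)
  have "f (t k) = g (t k)" if "k \<le> n" for k
    using that
  proof (induction k)
    case 0
    \<comment> \<open>Written as a zero multiple, so that homogeneity alone shows that linear maps
      send it to zero.\<close>
    have z: "t 0 = 0 \<cdot>\<^sub>v 0\<^sub>v n" by (auto simp: t_def)
    have "h (t 0) = \<zero>\<^bsub>W\<^esub>" if "h \<in> module_hom class_ring (cvec n) W" for h
      using module_hom_classD(1,3)[OF that, of "0\<^sub>v n"] smult_l_null[of "h (0\<^sub>v n)"]
      by (simp add: z module_vec_simps)
    from this[OF f] this[OF g] show ?case by simp
  next
    case (Suc k)
    have "t (Suc k) = t k + v $ k \<cdot>\<^sub>v unit_vec n k"
      by (intro eq_vecI) (auto simp: t_def unit_vec_def less_Suc_eq)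
    then show ?case
      using Suc t[of k] by (simp add: fD gD eq)
  qed
  moreover have "t n = v" using v by (auto simp: t_def)
  ultimately show ?thesis by auto
qed

lemma mult_mat_vec_module_hom:
  "A \<in> carrier_mat m n \<Longrightarrow> (\<lambda>v. A *\<^sub>v v) \<in> module_hom class_ring (cvec n) (cvec m)"
  by (rule module_hom_classI)
    (auto simp: module_vec_simps mult_add_distrib_mat_vec[of _ m n] mult_mat_vec[of _ m n])

lemma module_hom_cvec_matrix:
  assumes f: "f \<in> module_hom class_ring (cvec n) (cvec m)"
  obtains A where "A \<in> carrier_mat m n" "\<And>v. v \<in> carrier_vec n \<Longrightarrow> f v = A *\<^sub>v v"
proof
  define A where "A = mat_of_cols m (map (\<lambda>i. f (unit_vec n i)) [0..<n])"
  show A: "A \<in> carrier_mat m n" by (auto simp: A_def mat_of_cols_def)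
  have "f (unit_vec n i) = A *\<^sub>v unit_vec n i" if "i < n" for i
    using that module_hom_classD(1)[OF f, of "unit_vec n i"]
    by (simp add: mult_mat_unit_vec[OF A] module_vec_simps) (simp add: A_def)
  then show "f v = A *\<^sub>v v" if "v \<in> carrier_vec n" for v
    using that by (rule module_hom_cvec_eqI[OF vec_vs f mult_mat_vec_module_hom[OF A]])
qed

section \<open>Coordinate systems and change of basis\<close>

text \<open>An ordered basis encoded as a linear isomorphism: changing the basis is then composition
  of maps, and \<open>A\<close> is the matrix of \<open>T\<close> when
  \<open>T (E v) = E (A *\<^sub>v v)\<close>.\<close>

definition coordinates :: "(complex, 'v, 'm) module_scheme \<Rightarrow> nat \<Rightarrow> (complex vec \<Rightarrow> 'v) \<Rightarrow> bool" where
  "coordinates V n E \<longleftrightarrow>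
     E \<in> module_hom class_ring (cvec n) V \<and> bij_betw E (carrier_vec n) (carrier V)"

lemma coordinates_change:
  assumes E: "coordinates V n E" and E': "coordinates V m E'"
  obtains P where "P \<in> carrier_mat m n" "\<And>v. v \<in> carrier_vec n \<Longrightarrow> E v = E' (P *\<^sub>v v)"
proof -
  have "inv_into (carrier_vec m) E' \<in> module_hom class_ring V (cvec m)"
    using E' module_hom_class_inv_into[OF vec_vs, of E' m V]
    by (simp add: coordinates_def module_vec_simps)
  then obtain P where P: "P \<in> carrier_mat m n"
      "\<And>v. v \<in> carrier_vec n \<Longrightarrow> inv_into (carrier_vec m) E' (E v) = P *\<^sub>v v"
    using E module_hom_class_comp[of E "cvec n" V "inv_into (carrier_vec m) E'" "cvec m"]
    by (auto simp: coordinates_def elim: module_hom_cvec_matrix)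
  show ?thesis
  proof (rule that[OF P(1)])
    fix v :: "complex vec" assume "v \<in> carrier_vec n"
    then show "E v = E' (P *\<^sub>v v)"
      using E E' by (simp flip: P(2)) (metis bij_betw_apply bij_betw_inv_into_right coordinates_def)
  qed
qed

lemma coordinates_hom_matrix:
  assumes E: "coordinates V n E" and T: "T \<in> module_hom class_ring V V"
  obtains A where "A \<in> carrier_mat n n" "\<And>v. v \<in> carrier_vec n \<Longrightarrow> T (E v) = E (A *\<^sub>v v)"
proof -
  have "inv_into (carrier_vec n) E \<in> module_hom class_ring V (cvec n)"
    using E module_hom_class_inv_into[OF vec_vs, of E n V]
    by (simp add: coordinates_def module_vec_simps)
  then have "(\<lambda>v. inv_into (carrier_vec n) E (T v)) \<in> module_hom class_ring V (cvec n)"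
    by (rule module_hom_class_comp[OF T])
  then obtain A where A: "A \<in> carrier_mat n n"
      "\<And>v. v \<in> carrier_vec n \<Longrightarrow> inv_into (carrier_vec n) E (T (E v)) = A *\<^sub>v v"
    using E module_hom_class_comp[of E "cvec n" V "\<lambda>v. inv_into (carrier_vec n) E (T v)" "cvec n"]
    by (auto simp: coordinates_def elim: module_hom_cvec_matrix)
  show ?thesis
  proof (rule that[OF A(1)])
    fix v :: "complex vec" assume v: "v \<in> carrier_vec n"
    then have "E v \<in> carrier V" using E by (metis bij_betw_apply coordinates_def)
    from module_hom_classD(1)[OF T this] have "T (E v) \<in> carrier V" .
    then show "T (E v) = E (A *\<^sub>v v)"
      using E v by (simp flip: A(2)) (metis bij_betw_inv_into_right coordinates_def)
  qed
qed

lemma coordinates_inj: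
  "\<lbrakk>coordinates V n E; v \<in> carrier_vec n; w \<in> carrier_vec n\<rbrakk> \<Longrightarrow> E v = E w \<longleftrightarrow> v = w"
  by (auto simp: coordinates_def bij_betw_def dest: inj_onD)

text \<open>The transition matrices in the two directions are inverse to each other and conjugate
  \<open>A'\<close> into \<open>A\<close>. Each matrix identity is tested on vectors and read
  through the injective maps \<open>E\<close> and \<open>E'\<close>.\<close>

lemma coordinates_similar:
  assumes E: "coordinates V n E" and E': "coordinates V n E'"
    and A: "A \<in> carrier_mat n n" "\<And>v. v \<in> carrier_vec n \<Longrightarrow> T (E v) = E (A *\<^sub>v v)"
    and A': "A' \<in> carrier_mat n n" "\<And>v. v \<in> carrier_vec n \<Longrightarrow> T (E' v) = E' (A' *\<^sub>v v)"
  shows "similar_mat A A'"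
proof -
  obtain P where P: "P \<in> carrier_mat n n" "\<And>v. v \<in> carrier_vec n \<Longrightarrow> E v = E' (P *\<^sub>v v)"
    using coordinates_change[OF E E'] by blast
  obtain Q where Q: "Q \<in> carrier_mat n n" "\<And>v. v \<in> carrier_vec n \<Longrightarrow> E' v = E (Q *\<^sub>v v)"
    using coordinates_change[OF E' E] by blast
  note [simp] = mult_mat_vec_carrier[OF P(1)] mult_mat_vec_carrier[OF Q(1)]
    mult_mat_vec_carrier[OF A(1)] mult_mat_vec_carrier[OF A'(1)]
  note assoc = assoc_mult_mat_vec[of _ n n _ n]
  have PQ: "P * Q = 1\<^sub>m n"
  proof (rule mat_eqI_mult_vec)
    fix v :: "complex vec" assume v: "v \<in> carrier_vec n"
    have "E' (P *\<^sub>v (Q *\<^sub>v v)) = E' v" using v by (simp flip: P(2) Q(2))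
    then show "P * Q *\<^sub>v v = 1\<^sub>m n *\<^sub>v v"
      using P(1) Q(1) v coordinates_inj[OF E'] by (simp add: assoc)
  qed (use P(1) Q(1) in auto)
  have QP: "Q * P = 1\<^sub>m n"
  proof (rule mat_eqI_mult_vec)
    fix v :: "complex vec" assume v: "v \<in> carrier_vec n"
    have "E (Q *\<^sub>v (P *\<^sub>v v)) = E v" using v by (simp flip: P(2) Q(2))
    then show "Q * P *\<^sub>v v = 1\<^sub>m n *\<^sub>v v"
      using P(1) Q(1) v coordinates_inj[OF E] by (simp add: assoc)
  qed (use P(1) Q(1) in auto)
  have AQP: "A = Q * A' * P"
  proof (rule mat_eqI_mult_vec)
    fix v :: "complex vec" assume v: "v \<in> carrier_vec n"
    have "E (A *\<^sub>v v) = E (Q *\<^sub>v (A' *\<^sub>v (P *\<^sub>v v)))"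
      using v by (simp flip: P(2) Q(2) A(2) A'(2))
    then show "A *\<^sub>v v = Q * A' * P *\<^sub>v v"
      using P(1) Q(1) A(1) A'(1) v coordinates_inj[OF E] by (simp add: assoc assoc_mult_mat[of _ n n _ n _ n])
  qed (use P(1) Q(1) A(1) A'(1) in auto)
  show ?thesis
    by (rule similar_matI[OF _ QP PQ AQP]) (use P(1) Q(1) A(1) A'(1) in auto)
qed

text \<open>Precomposing \<open>E\<close> with the matrix \<open>P\<close> of the similarity gives
  the new coordinates. This is the passage from an arbitrary basis to a Jordan basis.\<close>

lemma coordinates_similar_transfer:
  assumes E: "coordinates V n E"
    and A: "A \<in> carrier_mat n n" "\<And>v. v \<in> carrier_vec n \<Longrightarrow> T (E v) = E (A *\<^sub>v v)"
    and sim: "similar_mat A A'"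
  obtains E' where "coordinates V n E'" "A' \<in> carrier_mat n n"
    "\<And>v. v \<in> carrier_vec n \<Longrightarrow> T (E' v) = E' (A' *\<^sub>v v)"
proof -
  obtain P Q where w: "similar_mat_wit A A' P Q" using sim by (auto simp: similar_mat_def)
  note [simp] = similar_mat_witD2(4-7)[OF A(1) w] and PQ = similar_mat_witD2(1-3)[OF A(1) w]
  note assoc = assoc_mult_mat_vec[of _ n n _ n]
  note [simp] = mult_mat_vec_carrier[of P n n] mult_mat_vec_carrier[of Q n n]
  let ?E = "\<lambda>v. E (P *\<^sub>v v)"
  have "bij_betw (\<lambda>v. P *\<^sub>v v) (carrier_vec n) (carrier_vec n)"
    by (rule bij_betw_byWitness[where f' = "\<lambda>v. Q *\<^sub>v v"]) (auto simp: PQ simp flip: assoc)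
  moreover have "(\<lambda>v. P *\<^sub>v v) \<in> module_hom class_ring (cvec n) (cvec n)"
    by (rule mult_mat_vec_module_hom) simp
  ultimately have "coordinates V n ?E"
    using E module_hom_class_comp[of "\<lambda>v. P *\<^sub>v v" "cvec n" "cvec n" E V]
      bij_betw_trans[of "\<lambda>v. P *\<^sub>v v" "carrier_vec n" "carrier_vec n" E "carrier V"]
    by (simp add: coordinates_def o_def)
  moreover have "T (?E v) = ?E (A' *\<^sub>v v)" if v: "v \<in> carrier_vec n" for v
  proof -
    have "Q *\<^sub>v (P *\<^sub>v v) = v" using v PQ(2) by (simp flip: assoc)
    moreover have "P * A' \<in> carrier_mat n n" by (rule mult_carrier_mat[of P n n A' n]) simp_all
    ultimately have "A *\<^sub>v (P *\<^sub>v v) = P *\<^sub>v (A' *\<^sub>v v)"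
      using v by (simp add: PQ(3) assoc)
    with v A show ?thesis by simp
  qed
  ultimately show ?thesis using that by auto
qed

text \<open>\<open>E\<close> takes a vector to the combination of \<open>bs\<close> with its entries
  as coefficients. It is bijective because coefficients in a basis exist and are unique.\<close>

lemma operator_matrix_coordinates:
  fixes V :: "(complex, 'v, 'm) module_scheme"
  assumes V: "vectorspace class_ring V" and op: "operator_matrix V bs T A"
    and T: "T \<in> module_hom class_ring V V"
  obtains E where "coordinates V (vectorspace.dim class_ring V) E"
    "A \<in> carrier_mat (vectorspace.dim class_ring V) (vectorspace.dim class_ring V)"
    "\<And>v. v \<in> carrier_vec (vectorspace.dim class_ring V) \<Longrightarrow> T (E v) = E (A *\<^sub>v v)"
proof -
  interpret vectorspace class_ring V by fact
  define n where "n = length bs"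
  have bs: "distinct bs" "basis (set bs)" and A: "A \<in> carrier_mat n n"
    and Tbs: "\<And>j. j < n \<Longrightarrow> T (bs ! j) = (\<Oplus>\<^bsub>V\<^esub>i\<in>{..<n}. A $$ (i, j) \<odot>\<^bsub>V\<^esub> bs ! i)"
    using op by (auto simp: operator_matrix_def n_def)
  have dim: "dim = n" using dim_basis[OF _ bs(2)] bs(1) by (simp add: n_def distinct_card)
  have bsV: "set bs \<subseteq> carrier V" using bs(2) by (simp add: basis_def)
  then have nth: "bs ! i \<in> carrier V" if "i < n" for i using that by (auto simp: n_def)
  have inj: "inj_on ((!) bs) {..<n}" using bs(1) by (auto simp: inj_on_def n_def nth_eq_iff_index_eq)
  have img: "(!) bs ` {..<n} = set bs" by (auto simp: n_def set_conv_nth)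
  define E where "E v = (\<Oplus>\<^bsub>V\<^esub>i\<in>{..<n}. v $ i \<odot>\<^bsub>V\<^esub> bs ! i)" for v
  have hom: "E \<in> module_hom class_ring (cvec n) V"
  proof (rule module_hom_classI, goal_cases)
    case (1 v)
    then show ?case using nth by (auto simp: E_def intro!: finsum_closed)
  next
    case (2 v w)
    then have "E (v + w) = (\<Oplus>\<^bsub>V\<^esub>i\<in>{..<n}. v $ i \<odot>\<^bsub>V\<^esub> bs ! i \<oplus>\<^bsub>V\<^esub> w $ i \<odot>\<^bsub>V\<^esub> bs ! i)"
      unfolding E_def using nth smult_l_distr
      by (intro finsum_cong') (auto simp: module_vec_simps)
    also have "\<dots> = E v \<oplus>\<^bsub>V\<^esub> E w"
      unfolding E_def using nth by (intro finsum_addf) auto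
    finally show ?case by (simp add: module_vec_simps)
  next
    case (3 c v)
    then have "E (c \<cdot>\<^sub>v v) = (\<Oplus>\<^bsub>V\<^esub>i\<in>{..<n}. c \<odot>\<^bsub>V\<^esub> (v $ i \<odot>\<^bsub>V\<^esub> bs ! i))"
      unfolding E_def using nth smult_assoc1
      by (intro finsum_cong') (auto simp: module_vec_simps)
    also have "\<dots> = c \<odot>\<^bsub>V\<^esub> E v"
      unfolding E_def using nth by (intro finsum_smult[symmetric]) auto
    finally show ?case by (simp add: module_vec_simps)
  qed
  \<comment> \<open>\<open>lincomb\<close> sums over the set of basis vectors, \<open>E\<close> over
    positions in the list. Distinctness of \<open>bs\<close> makes the reindexing injective.\<close>
  have lincomb: "E v = lincomb a (set bs)" if "\<And>i. i < n \<Longrightarrow> a (bs ! i) = v $ i" for a v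
  proof -
    have "lincomb a (set bs) = (\<Oplus>\<^bsub>V\<^esub>i\<in>{..<n}. a (bs ! i) \<odot>\<^bsub>V\<^esub> bs ! i)"
      unfolding lincomb_def img[symmetric] using nth inj by (intro finsum_reindex) auto
    also have "\<dots> = E v"
      unfolding E_def using nth that by (intro finsum_cong') auto
    finally show ?thesis ..
  qed
  have uniq: "\<exists>!a. a \<in> set bs \<rightarrow>\<^sub>E UNIV \<and> lincomb a (set bs) = v" if "v \<in> carrier V" for v
    using bs(2) that by (simp add: basis_criterion[OF _ bsV])
  have "bij_betw E (carrier_vec n) (carrier V)"
  proof (rule bij_betw_imageI[OF inj_onI subset_antisym[OF image_subsetI subsetI]])
    fix v w assume v: "v \<in> carrier_vec n" and w: "w \<in> carrier_vec n" and eq: "E v = E w"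
    \<comment> \<open>The entries of \<open>u\<close> as a function on basis vectors, restricted to
      \<open>set bs\<close> so that uniqueness among extensional coefficient functions
      applies.\<close>
    define a where "a u = (\<lambda>x\<in>set bs. u $ (inv_into {..<n} ((!) bs) x))" for u :: "complex vec"
    have a: "a u (bs ! i) = u $ i" if "i < n" for u i
      using that inj by (simp add: a_def n_def inv_into_f_f)
    have aE: "a u \<in> set bs \<rightarrow>\<^sub>E UNIV" for u by (auto simp: a_def)
    have "lincomb (a v) (set bs) = lincomb (a w) (set bs)"
      using lincomb[of "a v" v] lincomb[of "a w" w] a eq by simp
    moreover have "lincomb (a w) (set bs) \<in> carrier V" using bsV by (intro lincomb_closed) auto
    ultimately have "a v = a w" using aE uniq by metis
    with a v w show "v = w" by (intro eq_vecI) (auto, metis)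
  next
    fix v :: "complex vec" assume "v \<in> carrier_vec n"
    then show "E v \<in> carrier V" using module_hom_classD(1)[OF hom] by (auto simp: module_vec_simps)
  next
    fix x assume "x \<in> carrier V"
    then obtain a where "lincomb a (set bs) = x" using uniq by blast
    then have "E (vec n (\<lambda>i. a (bs ! i))) = x" using lincomb[of a] by simp
    then show "x \<in> E ` carrier_vec n" by force
  qed
  with hom have co: "coordinates V n E" by (simp add: coordinates_def)
  have unit: "E (unit_vec n j) = bs ! j" if "j < n" for j
  proof -
    have "E (unit_vec n j) = (\<Oplus>\<^bsub>V\<^esub>i\<in>{..<n}. if j = i then bs ! i else \<zero>\<^bsub>V\<^esub>)"
      unfolding E_def using nth that smult_one smult_l_null by (intro finsum_cong') auto
    also have "\<dots> = bs ! j" using nth that by (intro finsum_singleton) auto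
    finally show ?thesis .
  qed
  \<comment> \<open>Both sides are linear in the vector, so unit vectors suffice. There the claim is
    what the columns of \<open>A\<close> mean.\<close>
  have "T (E (unit_vec n j)) = E (A *\<^sub>v unit_vec n j)" if "j < n" for j
  proof -
    have "E (col A j) = (\<Oplus>\<^bsub>V\<^esub>i\<in>{..<n}. A $$ (i, j) \<odot>\<^bsub>V\<^esub> bs ! i)"
      unfolding E_def using A nth that by (intro finsum_cong') auto
    then show ?thesis using A that by (simp add: mult_mat_unit_vec[OF A] unit Tbs)
  qed
  then have "T (E v) = E (A *\<^sub>v v)" if "v \<in> carrier_vec n" for v
    using that by (rule module_hom_cvec_eqI[OF V module_hom_class_comp[OF hom T]
      module_hom_class_comp[OF mult_mat_vec_module_hom[OF A] hom]])
  with that co A show ?thesis by (simp add: dim)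
qed

section \<open>Direct sums of coordinate spaces\<close>

lemma dsum_space_simps:
  assumes "finite I"
  shows "carrier (dsum_space I V) = (\<Pi>\<^sub>E i\<in>I. carrier (V i))"
    and "\<zero>\<^bsub>dsum_space I V\<^esub> = (\<lambda>i\<in>I. \<zero>\<^bsub>V i\<^esub>)"
    and "f \<oplus>\<^bsub>dsum_space I V\<^esub> g = (\<lambda>i\<in>I. f i \<oplus>\<^bsub>V i\<^esub> g i)"
    and "c \<odot>\<^bsub>dsum_space I V\<^esub> f = (\<lambda>i\<in>I. c \<odot>\<^bsub>V i\<^esub> f i)"
  using assms by (auto simp: dsum_space_def)

lemma vectorspace_dsum_space:
  assumes I: "finite I" and V: "\<And>i. i \<in> I \<Longrightarrow> vectorspace class_ring (V i)"
  shows "vectorspace class_ring (dsum_space I V)"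
proof (rule vs_criteria)
  note ss = dsum_space_simps[OF I]
  have M: "Module.module class_ring (V i)" if "i \<in> I" for i
    using V[OF that] by (simp add: vectorspace_def)
  then have G: "abelian_group (V i)" if "i \<in> I" for i
    using that by (simp add: Module.module_def)
  note mon = abelian_group.axioms(1)[OF G]
  let ?W = "dsum_space I V"
  show "\<zero>\<^bsub>?W\<^esub> \<in> carrier ?W"
    by (auto simp: ss abelian_monoid.zero_closed[OF mon])
  show "\<forall>v w. v \<in> carrier ?W \<and> w \<in> carrier ?W \<longrightarrow> v \<oplus>\<^bsub>?W\<^esub> w \<in> carrier ?W"
    by (auto simp: ss PiE_iff intro!: abelian_monoid.a_closed[OF mon])
  show "\<forall>v\<in>carrier ?W. \<exists>w\<in>carrier ?W. v \<oplus>\<^bsub>?W\<^esub> w = \<zero>\<^bsub>?W\<^esub>"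
  proof
    fix v assume v: "v \<in> carrier ?W"
    show "\<exists>w\<in>carrier ?W. v \<oplus>\<^bsub>?W\<^esub> w = \<zero>\<^bsub>?W\<^esub>"
      using v by (intro bexI[of _ "\<lambda>i\<in>I. \<ominus>\<^bsub>V i\<^esub> v i"])
        (auto simp: ss PiE_iff abelian_group.r_neg[OF G] intro!: abelian_group.a_inv_closed[OF G])
  qed
  show "\<forall>c v. c \<in> carrier class_ring \<and> v \<in> carrier ?W \<longrightarrow> c \<odot>\<^bsub>?W\<^esub> v \<in> carrier ?W"
    by (auto simp: ss PiE_iff intro!: Module.module.smult_closed[OF M])
  show "\<forall>v w. v \<in> carrier ?W \<and> w \<in> carrier ?W \<longrightarrow> v \<oplus>\<^bsub>?W\<^esub> w = w \<oplus>\<^bsub>?W\<^esub> v"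
    by (auto simp: ss PiE_iff intro!: restrict_ext abelian_monoid.a_comm[OF mon])
  show "\<forall>v w x. v \<in> carrier ?W \<and> w \<in> carrier ?W \<and> x \<in> carrier ?W
      \<longrightarrow> v \<oplus>\<^bsub>?W\<^esub> w \<oplus>\<^bsub>?W\<^esub> x = v \<oplus>\<^bsub>?W\<^esub> (w \<oplus>\<^bsub>?W\<^esub> x)"
    by (auto simp: ss PiE_iff intro!: restrict_ext abelian_monoid.a_assoc[OF mon])
  show "\<forall>v\<in>carrier ?W. v \<oplus>\<^bsub>?W\<^esub> \<zero>\<^bsub>?W\<^esub> = v"
    by (auto simp: ss PiE_iff fun_eq_iff abelian_monoid.r_zero[OF mon] extensional_def)
  show "\<forall>a b v. a \<in> carrier class_ring \<and> b \<in> carrier class_ring \<and> v \<in> carrier ?W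
      \<longrightarrow> (a \<otimes>\<^bsub>class_ring\<^esub> b) \<odot>\<^bsub>?W\<^esub> v = a \<odot>\<^bsub>?W\<^esub> (b \<odot>\<^bsub>?W\<^esub> v)"
    using Module.module.smult_assoc1[OF M]
    by (auto simp: ss PiE_iff intro!: restrict_ext)
  show "\<forall>v\<in>carrier ?W. \<one>\<^bsub>class_ring\<^esub> \<odot>\<^bsub>?W\<^esub> v = v"
    using Module.module.smult_one[OF M]
    by (auto simp: ss PiE_iff fun_eq_iff extensional_def)
  show "\<forall>a b v. a \<in> carrier class_ring \<and> b \<in> carrier class_ring \<and> v \<in> carrier ?W
      \<longrightarrow> (a \<oplus>\<^bsub>class_ring\<^esub> b) \<odot>\<^bsub>?W\<^esub> v = a \<odot>\<^bsub>?W\<^esub> v \<oplus>\<^bsub>?W\<^esub> b \<odot>\<^bsub>?W\<^esub> v"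
    using Module.module.smult_l_distr[OF M]
    by (auto simp: ss PiE_iff intro!: restrict_ext)
  show "\<forall>a v w. a \<in> carrier class_ring \<and> v \<in> carrier ?W \<and> w \<in> carrier ?W
      \<longrightarrow> a \<odot>\<^bsub>?W\<^esub> (v \<oplus>\<^bsub>?W\<^esub> w) = a \<odot>\<^bsub>?W\<^esub> v \<oplus>\<^bsub>?W\<^esub> a \<odot>\<^bsub>?W\<^esub> w"
    using Module.module.smult_r_distr[OF M]
    by (auto simp: ss PiE_iff intro!: restrict_ext)
qed (rule class_field)

section \<open>Stacking block vectors into one column vector\<close>

text \<open>The direct sum has an unordered index set, whereas a column vector needs an order of its
  blocks, which the list supplies.\<close>

fun join_blocks :: "'i list \<Rightarrow> ('i \<Rightarrow> 'a vec) \<Rightarrow> 'a vec" where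
  "join_blocks [] f = vNil"
| "join_blocks (i # is) f = f i @\<^sub>v join_blocks is f"

lemma join_blocks_carrier:
  "(\<And>i. i \<in> set is \<Longrightarrow> f i \<in> carrier_vec (s i)) \<Longrightarrow> join_blocks is f \<in> carrier_vec (sum_list (map s is))"
  by (induction "is") auto

lemma join_blocks_cong:
  "(\<And>i. i \<in> set is \<Longrightarrow> f i = g i) \<Longrightarrow> join_blocks is f = join_blocks is g"
  by (induction "is") auto

lemma join_blocks_eq_iff:
  assumes "\<And>i. i \<in> set is \<Longrightarrow> f i \<in> carrier_vec (s i)" "\<And>i. i \<in> set is \<Longrightarrow> g i \<in> carrier_vec (s i)"
  shows "join_blocks is f = join_blocks is g \<longleftrightarrow> (\<forall>i\<in>set is. f i = g i)"
  using assms
proof (induction "is")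
  case (Cons i "is")
  then show ?case using append_vec_eq[of "f i" "s i" "g i"] by simp
qed simp

lemma join_blocks_surj:
  "\<lbrakk>distinct is; v \<in> carrier_vec (sum_list (map s is))\<rbrakk>
    \<Longrightarrow> \<exists>f. (\<forall>i\<in>set is. f i \<in> carrier_vec (s i)) \<and> join_blocks is f = v"
proof (induction "is" arbitrary: v)
  case (Cons i "is")
  let ?m = "sum_list (map s is)"
  obtain f where f: "\<forall>j\<in>set is. f j \<in> carrier_vec (s j)" "join_blocks is f = vec_last v ?m"
    using Cons.IH[of "vec_last v ?m"] Cons.prems by auto
  \<comment> \<open>Distinctness of the list keeps this update from disturbing the later
    blocks.\<close>
  define g where "g = f(i := vec_first v (s i))"
  have "join_blocks is g = join_blocks is f"
    using Cons.prems by (intro join_blocks_cong) (auto simp: g_def)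
  then have "join_blocks (i # is) g = v"
    using f(2) Cons.prems by (simp add: g_def)
  moreover have "\<forall>j\<in>set (i # is). g j \<in> carrier_vec (s j)"
    using f(1) by (auto simp: g_def)
  ultimately show ?case by blast
qed auto

lemma join_blocks_add:
  assumes "\<And>i. i \<in> set is \<Longrightarrow> f i \<in> carrier_vec (s i)" "\<And>i. i \<in> set is \<Longrightarrow> g i \<in> carrier_vec (s i)"
  shows "join_blocks is (\<lambda>i. f i + g i) = join_blocks is f + join_blocks is g"
  using assms
proof (induction "is")
  case (Cons i "is")
  then show ?case
    using append_vec_add[of "f i" "s i" "g i" "join_blocks is f" "sum_list (map s is)" "join_blocks is g"]
    by (simp add: join_blocks_carrier)
qed (auto intro: eq_vecI)

lemma join_blocks_smult:
  "join_blocks is (\<lambda>i. c \<cdot>\<^sub>v f i) = c \<cdot>\<^sub>v join_blocks is f"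
  by (induction "is") (auto intro!: eq_vecI)

text \<open>Splitting off the first diagonal block reduces the claim to the rest of the list. It
  carries the Jordan matrix over to the action on the direct sum.\<close>

lemma jordan_matrix_join_blocks:
  assumes "\<And>i. i \<in> set is \<Longrightarrow> f i \<in> carrier_vec (s i)"
  shows "jordan_matrix (map (\<lambda>z. (s z, z)) is) *\<^sub>v join_blocks is f
    = join_blocks is (\<lambda>z. jordan_block (s z) z *\<^sub>v f z)"
  using assms
proof (induction "is")
  case Nil
  show ?case by (intro eq_vecI) (auto simp: jordan_matrix_def)
next
  case (Cons i "is")
  let ?m = "sum_list (map s is)"
  have "jordan_matrix (map (\<lambda>z. (s z, z)) is) \<in> carrier_mat ?m ?m"
    using jordan_matrix_carrier[of "map (\<lambda>z. (s z, z)) is"] by (simp add: o_def)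
  then show ?case
    using Cons by (simp add: jordan_matrix_Cons o_def join_blocks_carrier
        mult_mat_vec_split[of _ "s i" _ ?m])
qed

lemma dsum_coordinates:
  fixes zs :: "complex list" and s :: "complex \<Rightarrow> nat"
  assumes "distinct zs"
  defines "W \<equiv> dsum_space (set zs) (\<lambda>z. cvec (s z))" and "n \<equiv> sum_list (map s zs)"
  shows "join_blocks zs \<in> module_hom class_ring W (cvec n)"
    and "bij_betw (join_blocks zs) (carrier W) (carrier_vec n)"
proof -
  note ss = dsum_space_simps[OF finite_set] module_vec_simps W_def n_def
  show "join_blocks zs \<in> module_hom class_ring W (cvec n)"
  proof (rule module_hom_classI, goal_cases)
    case (1 f)
    then show ?case by (auto simp: ss PiE_iff intro!: join_blocks_carrier)
  next
    case (2 f g)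
    then have "join_blocks zs (\<lambda>i. f i + g i) = join_blocks zs f + join_blocks zs g"
      by (intro join_blocks_add[of _ _ s]) (auto simp: ss PiE_iff)
    moreover have "join_blocks zs (f \<oplus>\<^bsub>W\<^esub> g) = join_blocks zs (\<lambda>i. f i + g i)"
      by (rule join_blocks_cong) (simp add: ss)
    ultimately show ?case by (simp add: ss)
  next
    case (3 c f)
    have "join_blocks zs (c \<odot>\<^bsub>W\<^esub> f) = join_blocks zs (\<lambda>i. c \<cdot>\<^sub>v f i)"
      by (rule join_blocks_cong) (simp add: ss)
    then show ?case by (simp add: ss join_blocks_smult)
  qed
  show "bij_betw (join_blocks zs) (carrier W) (carrier_vec n)"
  proof (rule bij_betw_imageI[OF inj_onI subset_antisym[OF image_subsetI subsetI]])
    fix f g assume "f \<in> carrier W" "g \<in> carrier W" "join_blocks zs f = join_blocks zs g"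
    then show "f = g"
      by (subst (asm) join_blocks_eq_iff[of _ _ s])
        (auto simp: ss PiE_iff intro: extensionalityI)
  next
    fix f assume "f \<in> carrier W"
    then show "join_blocks zs f \<in> carrier_vec n" by (auto simp: ss PiE_iff intro!: join_blocks_carrier)
  next
    fix v :: "complex vec" assume "v \<in> carrier_vec n"
    then obtain f where f: "\<forall>i\<in>set zs. f i \<in> carrier_vec (s i)" "join_blocks zs f = v"
      using join_blocks_surj[OF assms(1), of v s] by (auto simp: n_def)
    \<comment> \<open>Elements of the direct sum are extensional, so the preimage is cut down to the
      index set, which the stacked vector does not notice.\<close>
    have "join_blocks zs (restrict f (set zs)) = v"
      using f(2) join_blocks_cong[of zs "restrict f (set zs)" f] by simp
    then show "v \<in> join_blocks zs ` carrier W"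
      using f(1) by (intro rev_image_eqI[of "restrict f (set zs)"]) (auto simp: ss)
  qed
qed

section \<open>Quandle representations\<close>

lemma carrier_Aut_iff:
  "f \<in> carrier (Aut V) \<longleftrightarrow>
    f \<in> module_hom class_ring V V \<and> f \<in> extensional (carrier V) \<and> bij_betw f (carrier V) (carrier V)"
  by (auto simp: Aut_def Bij_def)

lemma quandle_rep_in_Aut:
  "\<lbrakk>quandle_rep X V \<psi>; x \<in> carrier X\<rbrakk> \<Longrightarrow> \<psi> x \<in> carrier (Aut V)"
  by (auto simp: quandle_rep_def quandle_hom_def Conj_def)

text \<open>The homomorphism identity multiplied on the right by \<open>\<psi> y\<close>, which
  removes the inverse in the conjugation.\<close>

lemma quandle_rep_intertwine:
  assumes rep: "quandle_rep X V \<psi>" and X: "quandle X"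
    and x: "x \<in> carrier X" and y: "y \<in> carrier X" and v: "v \<in> carrier V"
  shows "\<psi> (x \<triangleright>\<^bsub>X\<^esub> y) (\<psi> y v) = \<psi> y (\<psi> x v)"
proof -
  interpret G: group "Aut V" using rep by (intro group_Aut) (simp add: quandle_rep_def)
  have mem: "\<psi> x \<in> carrier (Aut V)" "\<psi> y \<in> carrier (Aut V)" "\<psi> (x \<triangleright>\<^bsub>X\<^esub> y) \<in> carrier (Aut V)"
    using quandle_rep_in_Aut[OF rep] x y quandle.qop_closed[OF X] by auto
  have mult: "(f \<otimes>\<^bsub>Aut V\<^esub> g) v = f (g v)" if "f \<in> carrier (Aut V)" "g \<in> carrier (Aut V)" for f g
    using that v by (simp add: Aut_def BijGroup_def compose_def)
  have "\<psi> (x \<triangleright>\<^bsub>X\<^esub> y) = \<psi> y \<otimes>\<^bsub>Aut V\<^esub> \<psi> x \<otimes>\<^bsub>Aut V\<^esub> inv\<^bsub>Aut V\<^esub> \<psi> y"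
    using rep x y by (simp add: quandle_rep_def quandle_hom_def Conj_def)
  then have "\<psi> (x \<triangleright>\<^bsub>X\<^esub> y) \<otimes>\<^bsub>Aut V\<^esub> \<psi> y = \<psi> y \<otimes>\<^bsub>Aut V\<^esub> \<psi> x"
    using mem by (simp add: G.m_assoc)
  then show ?thesis using mult mem by metis
qed

text \<open>Conjugating \<open>D\<close> by itself gives \<open>D\<close> back.\<close>

lemma constant_quandle_rep:
  assumes V: "vectorspace class_ring V" and X: "quandle X" and D: "D \<in> carrier (Aut V)"
    and \<phi>: "\<And>x. x \<in> carrier X \<Longrightarrow> \<phi> x = D"
  shows "quandle_rep X V \<phi>"
proof -
  interpret G: group "Aut V" using V by (rule group_Aut)
  have "D \<otimes>\<^bsub>Aut V\<^esub> D \<otimes>\<^bsub>Aut V\<^esub> inv\<^bsub>Aut V\<^esub> D = D" using D by (simp add: G.m_assoc)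
  then show ?thesis
    using V D \<phi> quandle.qop_closed[OF X] by (simp add: quandle_rep_def quandle_hom_def Conj_def)
qed

section \<open>Characteristic polynomial and Jordan form of an operator\<close>

text \<open>The definition chooses some matrix of \<open>T\<close>. Any other is similar to it and
  so has the same characteristic polynomial.\<close>

lemma operator_char_poly_eq:
  assumes V: "vectorspace class_ring V" and T: "T \<in> module_hom class_ring V V"
    and A: "operator_matrix V bs T A"
  shows "operator_char_poly V T = char_poly A"
proof -
  define A' where "A' = (SOME A. \<exists>bs. operator_matrix V bs T A)"
  have "\<exists>bs. operator_matrix V bs T A'"
    unfolding A'_def by (rule someI[of "\<lambda>A. \<exists>bs. operator_matrix V bs T A"]) (use A in blast)
  then obtain bs' where A': "operator_matrix V bs' T A'" ..
  obtain E where E: "coordinates V (vectorspace.dim class_ring V) E"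
      "A \<in> carrier_mat (vectorspace.dim class_ring V) (vectorspace.dim class_ring V)"
      "\<And>v. v \<in> carrier_vec (vectorspace.dim class_ring V) \<Longrightarrow> T (E v) = E (A *\<^sub>v v)"
    using operator_matrix_coordinates[OF V A T] by blast
  obtain E' where E': "coordinates V (vectorspace.dim class_ring V) E'"
      "A' \<in> carrier_mat (vectorspace.dim class_ring V) (vectorspace.dim class_ring V)"
      "\<And>v. v \<in> carrier_vec (vectorspace.dim class_ring V) \<Longrightarrow> T (E' v) = E' (A' *\<^sub>v v)"
    using operator_matrix_coordinates[OF V A' T] by blast
  have "similar_mat A' A" by (rule coordinates_similar[OF E'(1) E(1) E'(2,3) E(2,3)])
  then show ?thesis
    unfolding operator_char_poly_def A'_def[symmetric] by (rule char_poly_similar)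
qed

text \<open>The order of a root is the total size of the blocks with that eigenvalue. With distinct
  eigenvalues there is a single such block, so its size is the multiplicity.\<close>

lemma distinct_jordan_nf:
  fixes A :: "complex mat"
  assumes jnf: "jordan_nf A n_as" and dist: "distinct (map snd n_as)"
  shows "n_as = map (\<lambda>z. (order z (char_poly A), z)) (map snd n_as)"
    and "{z. poly (char_poly A) z = 0} = set (map snd n_as)"
proof -
  have filter: "filter (\<lambda>na. snd na = a) n_as = [(s, a)]" if "(s, a) \<in> set n_as" for s a
    using that dist
  proof (induction n_as)
    case (Cons na n_as)
    show ?case
    proof (cases "na = (s, a)")
      case True
      with Cons.prems have "filter (\<lambda>na. snd na = a) n_as = []" by (force simp: filter_empty_conv)
      with True show ?thesis by simp
    next
      case False
      with Cons.prems have mem: "(s, a) \<in> set n_as" by simp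
      then have "a \<in> snd ` set n_as" by force
      with Cons.prems have "snd na \<noteq> a" by auto
      with mem Cons show ?thesis by simp
    qed
  qed simp
  have order: "order a (char_poly A) = s" if "(s, a) \<in> set n_as" for s a
    using jordan_nf_order[OF jnf, of a] filter[OF that] by simp
  then show "n_as = map (\<lambda>z. (order z (char_poly A), z)) (map snd n_as)"
    by (subst map_map, intro map_idI[symmetric]) (auto simp: o_def)
  obtain m where "A \<in> carrier_mat m m"
    using jnf similar_matD[of A] by (auto simp: jordan_nf_def)
  then have "char_poly A \<noteq> 0" using degree_monic_char_poly[of A m] by auto
  then have root: "poly (char_poly A) z = 0 \<longleftrightarrow> order z (char_poly A) \<noteq> 0" for z
    by (simp add: order_root)
  show "{z. poly (char_poly A) z = 0} = set (map snd n_as)"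
  proof (intro Set.set_eqI iffI)
    fix z assume "z \<in> {z. poly (char_poly A) z = 0}"
    then have "filter (\<lambda>na. snd na = z) n_as \<noteq> []"
      using jordan_nf_order[OF jnf, of z] by (auto simp: root)
    then show "z \<in> set (map snd n_as)" by (auto simp: filter_empty_conv)
  next
    fix z assume "z \<in> set (map snd n_as)"
    then obtain s where s: "(s, z) \<in> set n_as" by auto
    \<comment> \<open>A Jordan normal form has no blocks of size 0, so every listed eigenvalue is a
      root.\<close>
    then have "s \<noteq> 0" using jnf by (force simp: jordan_nf_def)
    with order[OF s] show "z \<in> {z. poly (char_poly A) z = 0}" by (simp add: root)
  qed
qed

text \<open>The invariant line is spanned by the image of the first unit vector.\<close>

lemma upper_triangular_rep_reducible:
  assumes V: "vectorspace class_ring V" and E: "coordinates V n E" and n: "n > 1"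
    and J: "J \<in> carrier_mat n n" "upper_triangular J"
    and rep: "\<And>x v. \<lbrakk>x \<in> carrier X; v \<in> carrier_vec n\<rbrakk> \<Longrightarrow> \<psi> x (E v) = E (J *\<^sub>v v)"
  shows "\<not> irreducible_rep X V \<psi>"
proof
  interpret vectorspace class_ring V by fact
  define e where "e c = c \<cdot>\<^sub>v (unit_vec n 0 :: complex vec)" for c
  define W where "W = range (\<lambda>c. E (e c))"
  have e: "e c \<in> carrier_vec n" for c by (simp add: e_def)
  have hom: "E \<in> module_hom class_ring (cvec n) V" using E by (simp add: coordinates_def)
  note ED = module_hom_classD[OF hom, unfolded module_vec_simps]
  have add: "E (e c) \<oplus>\<^bsub>V\<^esub> E (e d) = E (e (c + d))" for c d
    using ED(2)[OF e e, of c d] by (simp add: e_def add_smult_distrib_vec)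
  have smult: "d \<odot>\<^bsub>V\<^esub> E (e c) = E (e (d * c))" for c d
    using ED(3)[OF e, of d c] by (simp add: e_def smult_smult_assoc)
  have zero: "\<zero>\<^bsub>V\<^esub> = E (e 0)"
    using smult[of 0 0] smult_l_null[OF ED(1)[OF e]] by simp
  have "submodule class_ring W V"
    by unfold_locales (use ED(1)[OF e] add smult zero in \<open>auto simp: W_def\<close>)
  moreover have "J *\<^sub>v e c = e (c * J $$ (0, 0))" for c
  proof -
    \<comment> \<open>Below the diagonal the first column of \<open>J\<close> is zero, so the first
      unit vector is an eigenvector.\<close>
    have "col J 0 = e (J $$ (0, 0))"
      using J n upper_triangularD[OF J(2), of 0] by (intro eq_vecI) (auto simp: e_def unit_vec_def)
    then show ?thesis
      using n by (simp add: e_def mult_mat_vec[OF J(1)] mult_mat_unit_vec[OF J(1)] smult_smult_assoc)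
  qed
  then have "\<psi> x ` W \<subseteq> W" if "x \<in> carrier X" for x
    using rep[OF that e] by (auto simp: W_def)
  ultimately have sub: "subrep X V \<psi> W"
    using V by (auto simp: subrep_def subspace_def)
  assume "irreducible_rep X V \<psi>"
  with sub have "W = {\<zero>\<^bsub>V\<^esub>} \<or> W = carrier V" by (simp add: irreducible_rep_def)
  \<comment> \<open>The line is nonzero, and since \<open>n > 1\<close> it misses the image of the
    second unit vector.\<close>
  then show False
  proof
    assume "W = {\<zero>\<^bsub>V\<^esub>}"
    then have "E (e 1) = E (e 0)" using zero by (auto simp: W_def)
    then have "e 1 = e 0" using coordinates_inj[OF E e e] by simp
    then have "e 1 $ 0 = e 0 $ 0" by simp
    with n show False by (simp add: e_def)
  next
    assume "W = carrier V"
    then have "E (unit_vec n 1) \<in> W" using ED(1)[of "unit_vec n 1"] by simp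
    then obtain c where "E (unit_vec n 1) = E (e c)" by (auto simp: W_def)
    then have "unit_vec n 1 = e c" using coordinates_inj[OF E _ e] by simp
    then have "unit_vec n 1 $ 1 = e c $ 1" by simp
    with n show False by (simp add: e_def)
  qed
qed

text \<open>Maximality gives different blocks different eigenvalues, so there is one block for each
  root of the characteristic polynomial, with the multiplicity as its size. The list
  \<open>zs\<close> fixes an order of the roots.\<close>

lemma maximal_rep_jordan_coordinates:
  assumes V: "vectorspace class_ring V" and T: "T \<in> module_hom class_ring V V"
    and max: "operator_power_maximal k V T"
  obtains E zs where "distinct zs" "set zs = {z. poly (operator_char_poly V T) z = 0}"
    "inj_on (\<lambda>z. z ^ k) (set zs)"
    "coordinates V (vectorspace.dim class_ring V) E"
    "vectorspace.dim class_ring V = (\<Sum>z\<leftarrow>zs. order z (operator_char_poly V T))"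
    "\<And>v. v \<in> carrier_vec (vectorspace.dim class_ring V) \<Longrightarrow>
      T (E v) = E (jordan_matrix (map (\<lambda>z. (order z (operator_char_poly V T), z)) zs) *\<^sub>v v)"
proof -
  obtain bs A n_as where op: "operator_matrix V bs T A" and jnf: "jordan_nf A n_as"
    and inj: "\<And>i j. \<lbrakk>i < length n_as; j < length n_as; i \<noteq> j\<rbrakk>
      \<Longrightarrow> snd (n_as ! i) ^ k \<noteq> snd (n_as ! j) ^ k"
    using max by (auto simp: operator_power_maximal_def power_maximal_def)
  define zs where "zs = map snd n_as"
  define \<rho> where "\<rho> = operator_char_poly V T"
  have \<rho>: "\<rho> = char_poly A" unfolding \<rho>_def by (rule operator_char_poly_eq[OF V T op])
  \<comment> \<open>This single statement yields both that the eigenvalues are distinct and that the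
    \<open>k\<close>-th power is injective on them.\<close>
  have "distinct (map (\<lambda>z. z ^ k) zs)"
    unfolding distinct_conv_nth zs_def using inj by auto
  then have dist: "distinct zs" and inj_on: "inj_on (\<lambda>z. z ^ k) (set zs)"
    by (simp_all add: distinct_map)
  note zs = distinct_jordan_nf[OF jnf dist[unfolded zs_def], folded zs_def \<rho>]
  let ?n = "vectorspace.dim class_ring V"
  obtain E where E: "coordinates V ?n E" "A \<in> carrier_mat ?n ?n"
      "\<And>v. v \<in> carrier_vec ?n \<Longrightarrow> T (E v) = E (A *\<^sub>v v)"
    using operator_matrix_coordinates[OF V op T] by blast
  have "similar_mat A (jordan_matrix n_as)" using jnf by (simp add: jordan_nf_def)
  then obtain E' where E': "coordinates V ?n E'" "jordan_matrix n_as \<in> carrier_mat ?n ?n"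
      "\<And>v. v \<in> carrier_vec ?n \<Longrightarrow> T (E' v) = E' (jordan_matrix n_as *\<^sub>v v)"
    using coordinates_similar_transfer[OF E] by metis
  have "?n = sum_list (map fst n_as)" using carrier_matD(1)[OF E'(2)] by simp
  also have "\<dots> = (\<Sum>z\<leftarrow>zs. order z \<rho>)" by (subst zs(1)) (simp add: o_def)
  finally show ?thesis
    using that[of zs E'] dist inj_on E' zs by (simp add: \<rho>_def)
qed

section \<open>Maximal representations are constant\<close>

lemma quandle_Alexander_primitive:
  assumes "field F" "primitive_element F \<alpha>"
  shows "quandle (Alexander F \<alpha>)"
  using assms field.quandle_Alexander[of F \<alpha>] by (simp add: primitive_element_def)

text \<open>In Jordan coordinates of \<open>\<psi> \<zero>\<close>, the matrices along the orbit of
  \<open>x\<close> under multiplication by \<open>\<alpha>\<close> form a periodic sequence of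
  conjugates, which \<open>periodic_conjugates_constant\<close> shows to be stationary.\<close>

lemma Alexander_rep_shift:
  assumes F: "field F" "finite (carrier F)" and prim: "primitive_element F \<alpha>"
    and rep: "quandle_rep (Alexander F \<alpha>) V \<psi>" and max: "maximal_rep F V \<psi>"
    and x: "x \<in> carrier F"
  shows "\<psi> (\<alpha> \<otimes>\<^bsub>F\<^esub> x) = \<psi> x"
proof -
  interpret field F by fact
  interpret M: group "mult_of F" by (rule field_mult_group)
  let ?X = "Alexander F \<alpha>" and ?k = "card (carrier F) - 1"
  have X: "quandle ?X" by (rule quandle_Alexander_primitive[OF F(1) prim])
  have V: "vectorspace class_ring V" using rep by (simp add: quandle_rep_def)
  let ?n = "vectorspace.dim class_ring V"
  have \<alpha>: "\<alpha> \<in> carrier F" "\<alpha> \<in> carrier (mult_of F)" using prim by (auto simp: primitive_element_def)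
  have carr: "carrier ?X = carrier F" by (simp add: Alexander_def)
  have Aut: "\<psi> y \<in> module_hom class_ring V V" "\<psi> y \<in> extensional (carrier V)"
      "bij_betw (\<psi> y) (carrier V) (carrier V)" if "y \<in> carrier F" for y
    using quandle_rep_in_Aut[OF rep, of y] that by (auto simp: carr carrier_Aut_iff)
  define \<rho> where "\<rho> = operator_char_poly V (\<psi> \<zero>\<^bsub>F\<^esub>)"
  obtain zs E where "distinct zs" "set zs = {z. poly \<rho> z = 0}"
    and zs: "inj_on (\<lambda>z. z ^ ?k) (set zs)" and E: "coordinates V ?n E"
    and n: "?n = (\<Sum>z\<leftarrow>zs. order z \<rho>)"
    and EJ: "\<And>v. v \<in> carrier_vec ?n \<Longrightarrow>
      \<psi> \<zero>\<^bsub>F\<^esub> (E v) = E (jordan_matrix (map (\<lambda>z. (order z \<rho>, z)) zs) *\<^sub>v v)"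
    by (rule maximal_rep_jordan_coordinates[OF V Aut(1)[OF zero_closed] max[unfolded maximal_rep_def],
      folded \<rho>_def]) (rule that)
  define n_as where "n_as = map (\<lambda>z. (order z \<rho>, z)) zs"
  define J where "J = jordan_matrix n_as"
  have sum: "sum_list (map fst n_as) = ?n" by (subst n) (simp add: n_as_def o_def)
  have J: "J \<in> carrier_mat ?n ?n" using jordan_matrix_carrier[of n_as] by (simp add: J_def sum)
  have ut: "upper_triangular J"
    using J jordan_matrix_upper_triangular[of _ n_as] by (auto simp: J_def sum)
  have diag: "J $$ (i, i) \<in> set zs" if "i < ?n" for i
  proof -
    have "J $$ (i, i) \<in> snd ` set n_as"
      using jordan_matrix_diag_in[of i n_as] that by (simp add: J_def sum)
    then show ?thesis by (auto simp: n_as_def)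
  qed
  note EJ = EJ[folded n_as_def J_def]
  have hom: "E \<in> module_hom class_ring (cvec ?n) V" using E by (simp add: coordinates_def)
  note ED = module_hom_classD(1)[OF hom, unfolded module_vec_simps]
  have Jv: "J *\<^sub>v v \<in> carrier_vec ?n" if "v \<in> carrier_vec ?n" for v
    using J that by (rule mult_mat_vec_carrier)
  \<comment> \<open>\<open>\<psi> \<zero>\<close> is injective, hence so is \<open>J\<close>.
    Nonzero eigenvalues are essential below, since 0 is unchanged by multiplication with any
    \<open>\<zeta>\<close>.\<close>
  have "det J \<noteq> 0"
  proof
    assume "det J = 0"
    then obtain v where v: "v \<in> carrier_vec ?n" "v \<noteq> 0\<^sub>v ?n" "J *\<^sub>v v = 0\<^sub>v ?n"
      using det_0_iff_vec_prod_zero[OF J] by auto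
    moreover have "J *\<^sub>v 0\<^sub>v ?n = 0\<^sub>v ?n" using J by (auto intro!: eq_vecI)
    ultimately have "\<psi> \<zero>\<^bsub>F\<^esub> (E v) = \<psi> \<zero>\<^bsub>F\<^esub> (E (0\<^sub>v ?n))" by (simp add: EJ)
    then have "E v = E (0\<^sub>v ?n)"
      using Aut(3)[OF zero_closed] ED v(1) by (auto simp: bij_betw_def dest: inj_onD)
    with v show False using coordinates_inj[OF E v(1)] by simp
  qed
  then have diag0: "J $$ (i, i) \<noteq> 0" if "i < ?n" for i
    using that J by (auto simp: det_upper_triangular[OF ut J] prod_list_zero_iff diag_mat_def)
  have "\<exists>A. A \<in> carrier_mat ?n ?n \<and> (\<forall>v\<in>carrier_vec ?n. \<psi> y (E v) = E (A *\<^sub>v v))"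
    if "y \<in> carrier F" for y
    using coordinates_hom_matrix[OF E Aut(1)[OF that]] by metis
  then obtain B where B: "\<And>y. y \<in> carrier F \<Longrightarrow> B y \<in> carrier_mat ?n ?n"
      "\<And>y v. \<lbrakk>y \<in> carrier F; v \<in> carrier_vec ?n\<rbrakk> \<Longrightarrow> \<psi> y (E v) = E (B y *\<^sub>v v)"
    by metis
  have JB: "J * B y = B (\<alpha> \<otimes>\<^bsub>F\<^esub> y) * J" if y: "y \<in> carrier F" for y
  proof (rule mat_eqI_mult_vec)
    have \<alpha>y: "\<alpha> \<otimes>\<^bsub>F\<^esub> y \<in> carrier F" using \<alpha> y by simp
    show "J * B y \<in> carrier_mat ?n ?n" "B (\<alpha> \<otimes>\<^bsub>F\<^esub> y) * J \<in> carrier_mat ?n ?n"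
      using J B(1)[OF y] B(1)[OF \<alpha>y] by auto
    fix v :: "complex vec" assume v: "v \<in> carrier_vec ?n"
    have op: "y \<triangleright>\<^bsub>?X\<^esub> \<zero>\<^bsub>F\<^esub> = \<alpha> \<otimes>\<^bsub>F\<^esub> y" using \<alpha> y by (simp add: Alexander_def)
    have carrier: "B y *\<^sub>v v \<in> carrier_vec ?n" "B (\<alpha> \<otimes>\<^bsub>F\<^esub> y) *\<^sub>v (J *\<^sub>v v) \<in> carrier_vec ?n"
      using mult_mat_vec_carrier B(1)[OF y] B(1)[OF \<alpha>y] Jv[OF v] v by blast+
    have "\<psi> (\<alpha> \<otimes>\<^bsub>F\<^esub> y) (\<psi> \<zero>\<^bsub>F\<^esub> (E v)) = \<psi> \<zero>\<^bsub>F\<^esub> (\<psi> y (E v))"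
      using quandle_rep_intertwine[OF rep X, of y "\<zero>\<^bsub>F\<^esub>"] y v ED by (simp add: carr op)
    then have "E (B (\<alpha> \<otimes>\<^bsub>F\<^esub> y) *\<^sub>v (J *\<^sub>v v)) = E (J *\<^sub>v (B y *\<^sub>v v))"
      by (simp only: EJ[OF v] EJ[OF carrier(1)] B(2)[OF y v] B(2)[OF \<alpha>y Jv[OF v]])
    then show "J * B y *\<^sub>v v = B (\<alpha> \<otimes>\<^bsub>F\<^esub> y) * J *\<^sub>v v"
      using coordinates_inj[OF E carrier(2) Jv[OF carrier(1)]]
      by (simp add: assoc_mult_mat_vec[OF J B(1)[OF y] v] assoc_mult_mat_vec[OF B(1)[OF \<alpha>y] J v])
  qed
  define C where "C t = B (\<alpha> [^]\<^bsub>F\<^esub> t \<otimes>\<^bsub>F\<^esub> x)" for t :: nat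
  have "0 < ?k" using \<alpha> F(2) card_mono[of "carrier F" "{\<zero>\<^bsub>F\<^esub>, \<one>\<^bsub>F\<^esub>}"] by simp
  \<comment> \<open>The multiplicative group has order \<open>?k\<close>, which makes the sequence
    \<open>C\<close> periodic with period \<open>?k\<close>.\<close>
  have "\<alpha> [^]\<^bsub>F\<^esub> ?k = \<one>\<^bsub>F\<^esub>"
    using M.pow_order_eq_1[OF \<alpha>(2)] order_mult_of[OF F(2)] by (simp add: nat_pow_mult_of Coset.order_def)
  then have "C (t + ?k) = C t" for t
    using \<alpha> by (simp add: C_def flip: nat_pow_mult)
  moreover have "C t \<in> carrier_mat ?n ?n" for t using \<alpha> x by (simp add: C_def B(1))
  moreover have "J * C t = C (Suc t) * J" for t
    using JB[of "\<alpha> [^]\<^bsub>F\<^esub> t \<otimes>\<^bsub>F\<^esub> x"] \<alpha> x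
    by (simp add: C_def m_assoc[symmetric] m_comm[of \<alpha>])
  \<comment> \<open>Eigenvalues that differ by a \<open>?k\<close>-th root of unity have equal
    \<open>?k\<close>-th powers. Maximality makes them equal, and being nonzero they force
    \<open>\<zeta> = 1\<close>.\<close>
  moreover have "J $$ (j, j) \<noteq> \<zeta> * J $$ (i, i)"
    if "\<zeta> ^ ?k = 1" "\<zeta> \<noteq> 1" "i < ?n" "j < ?n" for \<zeta> i j
  proof
    assume eq: "J $$ (j, j) = \<zeta> * J $$ (i, i)"
    then have "J $$ (j, j) ^ ?k = J $$ (i, i) ^ ?k" using that(1) by (simp add: power_mult_distrib)
    then have "J $$ (j, j) = J $$ (i, i)" using inj_onD[OF zs] diag that by blast
    with eq diag0[OF \<open>i < ?n\<close>] that(2) show False by simp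
  qed
  ultimately have "C 1 = C 0"
    using periodic_conjugates_constant[OF J ut, of C ?k] \<open>0 < ?k\<close> by blast
  then have Bx: "B (\<alpha> \<otimes>\<^bsub>F\<^esub> x) = B x" using \<alpha> x by (simp add: C_def)
  have \<alpha>x: "\<alpha> \<otimes>\<^bsub>F\<^esub> x \<in> carrier F" using \<alpha> x by simp
  show ?thesis
  proof (rule extensionalityI[OF Aut(2)[OF \<alpha>x] Aut(2)[OF x]])
    fix w assume "w \<in> carrier V"
    then obtain v where "v \<in> carrier_vec ?n" "w = E v" using E by (auto simp: coordinates_def bij_betw_def)
    then show "\<psi> (\<alpha> \<otimes>\<^bsub>F\<^esub> x) w = \<psi> x w" using B(2) x \<alpha>x Bx by simp
  qed
qed

lemma maximal_Alexander_rep_constant: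
  assumes F: "field F" "finite (carrier F)" "card (carrier F) > 2" and prim: "primitive_element F \<alpha>"
    and rep: "quandle_rep (Alexander F \<alpha>) V \<psi>" and max: "maximal_rep F V \<psi>"
    and x: "x \<in> carrier F"
  shows "\<psi> x = \<psi> \<zero>\<^bsub>F\<^esub>"
proof -
  interpret field F by fact
  interpret M: group "mult_of F" by (rule field_mult_group)
  let ?X = "Alexander F \<alpha>"
  have X: "quandle ?X" by (rule quandle_Alexander_primitive[OF F(1) prim])
  have \<alpha>: "\<alpha> \<in> carrier F" "\<alpha> \<in> carrier (mult_of F)"
    and gen: "generate (mult_of F) {\<alpha>} = carrier (mult_of F)"
    using prim by (auto simp: primitive_element_def)
  note shift = Alexander_rep_shift[OF F(1,2) prim rep max]
  have inv: "\<psi> (inv\<^bsub>mult_of F\<^esub> \<alpha> \<otimes>\<^bsub>F\<^esub> y) = \<psi> y" if "y \<in> carrier F" for y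
  proof -
    have c: "inv\<^bsub>mult_of F\<^esub> \<alpha> \<in> carrier F" using M.inv_closed[OF \<alpha>(2)] by simp
    have "\<alpha> \<otimes>\<^bsub>F\<^esub> inv\<^bsub>mult_of F\<^esub> \<alpha> = \<one>\<^bsub>F\<^esub>" using M.r_inv[OF \<alpha>(2)] by simp
    then show ?thesis
      using shift[of "inv\<^bsub>mult_of F\<^esub> \<alpha> \<otimes>\<^bsub>F\<^esub> y"] \<alpha> c that by (simp flip: m_assoc)
  qed
  \<comment> \<open>Invariance passes from \<open>\<alpha>\<close> to the group it generates. As
    \<open>\<alpha>\<close> is primitive, \<open>g\<close> runs over all nonzero elements.\<close>
  have "\<forall>y\<in>carrier F. \<psi> (g \<otimes>\<^bsub>F\<^esub> y) = \<psi> y" if "g \<in> generate (mult_of F) {\<alpha>}" for g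
    using that
  proof induction
    case (eng g h)
    then have "g \<in> carrier F" "h \<in> carrier F" using gen by auto
    with eng.IH show ?case by (simp add: m_assoc)
  qed (auto simp: shift inv)
  then have const: "\<psi> y = \<psi> \<one>\<^bsub>F\<^esub>" if "y \<in> carrier F" "y \<noteq> \<zero>\<^bsub>F\<^esub>" for y
    using that gen by (metis DiffI carrier_mult_of one_closed r_one singletonD)
  \<comment> \<open>If \<open>\<alpha>\<close> were 1, the group it generates would be trivial and
    the field would have two elements.\<close>
  have "\<alpha> \<noteq> \<one>\<^bsub>F\<^esub>"
  proof
    assume "\<alpha> = \<one>\<^bsub>F\<^esub>"
    then have "carrier F - {\<zero>\<^bsub>F\<^esub>} = {\<one>\<^bsub>F\<^esub>}"
      using gen M.generate_one by simp
    then have "carrier F = {\<zero>\<^bsub>F\<^esub>, \<one>\<^bsub>F\<^esub>}" by auto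
    then show False using F(3) card_insert_le_m1[of 2 "{\<one>\<^bsub>F\<^esub>}"] by simp
  qed
  then have d: "\<one>\<^bsub>F\<^esub> \<ominus>\<^bsub>F\<^esub> \<alpha> \<in> carrier F" "\<one>\<^bsub>F\<^esub> \<ominus>\<^bsub>F\<^esub> \<alpha> \<noteq> \<zero>\<^bsub>F\<^esub>"
    using \<alpha> by auto
  have rel: "\<psi> (y \<triangleright>\<^bsub>?X\<^esub> z) (\<psi> z v) = \<psi> z (\<psi> y v)"
    if "y \<in> carrier F" "z \<in> carrier F" "v \<in> carrier V" for y z v
    using quandle_rep_intertwine[OF rep X] that by (simp add: Alexander_def)
  have Aut: "\<psi> y \<in> extensional (carrier V)"
      "bij_betw (\<psi> y) (carrier V) (carrier V)" if "y \<in> carrier F" for y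
    using quandle_rep_in_Aut[OF rep, of y] that by (auto simp: Alexander_def carrier_Aut_iff)
  \<comment> \<open>Here \<open>\<one> \<triangleright> \<zero> = \<alpha>\<close>, and
    \<open>\<psi>\<close> takes the same value at \<open>\<alpha>\<close> and at 1.\<close>
  have comm: "\<psi> \<one>\<^bsub>F\<^esub> (\<psi> \<zero>\<^bsub>F\<^esub> v) = \<psi> \<zero>\<^bsub>F\<^esub> (\<psi> \<one>\<^bsub>F\<^esub> v)" if "v \<in> carrier V" for v
    using rel[of "\<one>\<^bsub>F\<^esub>" "\<zero>\<^bsub>F\<^esub>" v] that \<alpha> shift[of "\<one>\<^bsub>F\<^esub>"] by (simp add: Alexander_def)
  have "\<psi> \<zero>\<^bsub>F\<^esub> = \<psi> \<one>\<^bsub>F\<^esub>"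
  proof (rule extensionalityI[OF Aut(1) Aut(1)])
    fix w assume "w \<in> carrier V"
    \<comment> \<open>Writing \<open>w\<close> as an image under \<open>\<psi> \<one>\<close> brings
      it into the form to which the relation for \<open>\<zero> \<triangleright> \<one>\<close>
      applies.\<close>
    then obtain v where v: "v \<in> carrier V" "w = \<psi> \<one>\<^bsub>F\<^esub> v"
      using Aut(2)[of "\<one>\<^bsub>F\<^esub>"] by (auto simp: bij_betw_def)
    have "\<psi> \<one>\<^bsub>F\<^esub> w = \<psi> (\<zero>\<^bsub>F\<^esub> \<triangleright>\<^bsub>?X\<^esub> \<one>\<^bsub>F\<^esub>) (\<psi> \<one>\<^bsub>F\<^esub> v)"
      using d \<alpha> v const[OF d] by (simp add: Alexander_def)
    also have "\<dots> = \<psi> \<zero>\<^bsub>F\<^esub> w" using rel v comm by simp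
    finally show "\<psi> \<zero>\<^bsub>F\<^esub> w = \<psi> \<one>\<^bsub>F\<^esub> w" by simp
  qed auto
  with const[OF x] show ?thesis by (cases "x = \<zero>\<^bsub>F\<^esub>") simp_all
qed

section \<open>Decomposition into Jordan blocks\<close>

text \<open>On its carrier \<open>D\<close> equals \<open>T\<close> conjugated by the isomorphism
  \<open>G\<close>, so it inherits linearity and bijectivity from \<open>T\<close> without a
  blockwise check. The inverse of \<open>G\<close> is the intertwiner.\<close>

lemma constant_rep_isomorphic:
  assumes X: "quandle X" and rep: "quandle_rep X V \<psi>" and W: "vectorspace class_ring W"
    and T: "\<And>x. x \<in> carrier X \<Longrightarrow> \<psi> x = T"
    and G: "G \<in> module_hom class_ring W V" "bij_betw G (carrier W) (carrier V)"
    and \<phi>: "\<And>x. x \<in> carrier X \<Longrightarrow> \<phi> x = D" and ext: "D \<in> extensional (carrier W)"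
    and D: "\<And>f. f \<in> carrier W \<Longrightarrow> D f \<in> carrier W"
    and TG: "\<And>f. f \<in> carrier W \<Longrightarrow> T (G f) = G (D f)"
    and Aut: "T \<in> carrier (Aut V)"
  shows "rep_isomorphic X V \<psi> W \<phi>"
proof -
  interpret W: vectorspace class_ring W by fact
  let ?H = "inv_into (carrier W) G"
  have H: "?H \<in> module_hom class_ring V W" "bij_betw ?H (carrier V) (carrier W)"
    using module_hom_class_inv_into[OF W G] bij_betw_inv_into[OF G(2)] by auto
  have HG: "?H (G f) = f" if "f \<in> carrier W" for f
    using G(2) that by (simp add: bij_betw_def inv_into_f_f)
  have GH: "G (?H v) = v" if "v \<in> carrier V" for v
    using G(2) that by (simp add: bij_betw_inv_into_right)
  have DT: "D f = ?H (T (G f))" if "f \<in> carrier W" for f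
    using HG D TG that by simp
  have "T \<in> module_hom class_ring V V" "bij_betw T (carrier V) (carrier V)"
    using Aut by (simp_all add: carrier_Aut_iff)
  then have hom: "(\<lambda>f. ?H (T (G f))) \<in> module_hom class_ring W W"
    and bij: "bij_betw (\<lambda>f. ?H (T (G f))) (carrier W) (carrier W)"
    using module_hom_class_comp[OF module_hom_class_comp[OF G(1)] H(1)]
      bij_betw_trans[OF bij_betw_trans[OF G(2)] H(2)] by (auto simp: o_def)
  have "D \<in> module_hom class_ring W W"
    using module_hom_classD[OF hom] by (intro module_hom_classI) (simp_all add: DT)
  moreover have "bij_betw D (carrier W) (carrier W)"
    using bij DT by (simp cong: bij_betw_cong)
  ultimately have "quandle_rep X W \<phi>"
    using ext by (intro constant_quandle_rep[OF W X _ \<phi>]) (auto simp: carrier_Aut_iff)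
  moreover have "?H (\<psi> x v) = \<phi> x (?H v)" if "x \<in> carrier X" "v \<in> carrier V" for x v
    using that T \<phi> module_hom_classD(1)[OF H(1)] by (simp add: DT GH)
  ultimately show ?thesis
    using rep H by (auto simp: rep_isomorphic_def)
qed

theorem theorem6p4:
  fixes F :: "('a, 'm) ring_scheme" and \<alpha> :: 'a
    and V :: "(complex, 'v, 'n) module_scheme" and \<psi> :: "'a \<Rightarrow> 'v \<Rightarrow> 'v"
  assumes "field F" and "finite (carrier F)" and "card (carrier F) > 2"
    and "primitive_element F \<alpha>"
    and "vectorspace class_ring V" and "vectorspace.fin_dim class_ring V"
    and "vectorspace.dim class_ring V > 1"
    and "quandle_rep (Alexander F \<alpha>) V \<psi>"
    and "maximal_rep F V \<psi>"
  shows "(\<exists>T. \<forall>x\<in>carrier (Alexander F \<alpha>). \<psi> x = T)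
    \<and> (let \<rho> = operator_char_poly V (\<psi> \<zero>\<^bsub>F\<^esub>);
           Z = {z. poly \<rho> z = 0};
           J = (\<lambda>z. jordan_block (order z \<rho>) z)
       in rep_isomorphic (Alexander F \<alpha>) V \<psi>
            (dsum_space Z (\<lambda>z. U_space (J z)))
            (dsum_rep Z (\<lambda>z. U_space (J z)) (\<lambda>z. U_rep (J z))))
    \<and> \<not> irreducible_rep (Alexander F \<alpha>) V \<psi>"
proof -
  interpret field F by fact
  let ?X = "Alexander F \<alpha>" and ?n = "vectorspace.dim class_ring V"
  define T where "T = \<psi> \<zero>\<^bsub>F\<^esub>"
  define \<rho> where "\<rho> = operator_char_poly V T"
  define Z where "Z = {z. poly \<rho> z = 0}"
  define U where "U z = U_space (jordan_block (order z \<rho>) z)" for z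
  define R where "R z = (U_rep (jordan_block (order z \<rho>) z) :: 'a \<Rightarrow> complex vec \<Rightarrow> complex vec)" for z
  have X: "quandle ?X" by (rule quandle_Alexander_primitive[OF assms(1,4)])
  have carr: "carrier ?X = carrier F" by (simp add: Alexander_def)
  have const: "\<psi> x = T" if "x \<in> carrier ?X" for x
    using that unfolding T_def carr by (rule maximal_Alexander_rep_constant[OF assms(1-4,8,9)])
  have Aut: "T \<in> carrier (Aut V)"
    using quandle_rep_in_Aut[OF assms(8), of "\<zero>\<^bsub>F\<^esub>"] by (simp add: T_def carr)
  then have hom: "T \<in> module_hom class_ring V V" by (simp add: carrier_Aut_iff)
  obtain zs E where zs: "distinct zs" "set zs = Z"
    and "inj_on (\<lambda>z. z ^ (card (carrier F) - 1)) (set zs)" and E: "coordinates V ?n E"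
    and n: "?n = (\<Sum>z\<leftarrow>zs. order z \<rho>)"
    and TE: "\<And>v. v \<in> carrier_vec ?n \<Longrightarrow>
      T (E v) = E (jordan_matrix (map (\<lambda>z. (order z \<rho>, z)) zs) *\<^sub>v v)"
    by (rule maximal_rep_jordan_coordinates[OF assms(5) hom assms(9)[unfolded maximal_rep_def, folded T_def],
      folded \<rho>_def, folded Z_def]) (rule that)
  define J where "J = jordan_matrix (map (\<lambda>z. (order z \<rho>, z)) zs)"
  have J: "J \<in> carrier_mat ?n ?n" "upper_triangular J"
    using jordan_matrix_carrier[of "map (\<lambda>z. (order z \<rho>, z)) zs"]
      jordan_matrix_upper_triangular[of _ "map (\<lambda>z. (order z \<rho>, z)) zs"]
    by (auto simp: J_def n o_def)
  \<comment> \<open>By constancy all elements act through the same upper triangular matrix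
    \<open>J\<close>, so the line of its first eigenvector is a subrepresentation.\<close>
  have "\<not> irreducible_rep ?X V \<psi>"
    using TE const by (intro upper_triangular_rep_reducible[OF assms(5) E assms(7) J]) (simp add: J_def)
  moreover have "rep_isomorphic ?X V \<psi> (dsum_space Z U) (dsum_rep Z U R)"
  proof -
    let ?W = "dsum_space Z U" and ?s = "\<lambda>z. order z \<rho>"
    have U: "U = (\<lambda>z. cvec (?s z))" by (simp add: U_def U_space_def fun_eq_iff)
    have fin: "finite Z" using zs by (metis finite_set)
    have W: "vectorspace class_ring ?W" using fin by (intro vectorspace_dsum_space) (simp_all add: U vec_vs)
    note join = dsum_coordinates[OF zs(1), of ?s, folded n, unfolded zs(2), folded U]
    \<comment> \<open>The isomorphism from the direct sum to \<open>V\<close>: stack the components,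
      then apply the Jordan coordinates. \<open>?D\<close> is the common action of all quandle
      elements on the direct sum.\<close>
    let ?G = "\<lambda>f. E (join_blocks zs f)"
    let ?D = "\<lambda>f\<in>carrier ?W. \<lambda>z\<in>Z. jordan_block (?s z) z *\<^sub>v f z"
    have carrW: "carrier ?W = (\<Pi>\<^sub>E z\<in>Z. carrier_vec (?s z))"
      by (simp add: dsum_space_simps[OF fin] U module_vec_simps)
    have "?G \<in> module_hom class_ring ?W V" "bij_betw ?G (carrier ?W) (carrier V)"
      using module_hom_class_comp[OF join(1)] bij_betw_trans[OF join(2)] E
      by (auto simp: coordinates_def o_def)
    moreover have "dsum_rep Z U R x = ?D" for x
      unfolding dsum_rep_def
      by (intro restrict_ext) (auto simp: carrW R_def U_rep_def U_space_def module_vec_simps PiE_iff)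
    moreover have "?D f \<in> carrier ?W" if "f \<in> carrier ?W" for f
      using that mult_mat_vec_carrier[OF jordan_block_carrier]
      by (auto simp: carrW PiE_iff)
    moreover have "T (?G f) = ?G (?D f)" if "f \<in> carrier ?W" for f
    proof -
      have "join_blocks zs f \<in> carrier_vec ?n" using join(2) that by (rule bij_betw_apply)
      moreover have "jordan_matrix (map (\<lambda>z. (?s z, z)) zs) *\<^sub>v join_blocks zs f
          = join_blocks zs (\<lambda>z. jordan_block (?s z) z *\<^sub>v f z)"
        using that zs(2) by (intro jordan_matrix_join_blocks) (auto simp: carrW PiE_iff)
      moreover have "\<dots> = join_blocks zs (?D f)"
        using that zs(2) by (intro join_blocks_cong) simp
      ultimately show ?thesis by (simp add: TE)
    qed
    ultimately show ?thesis
      by (intro constant_rep_isomorphic[OF X assms(8) W const _ _ _ _ _ _ Aut, where D = ?D]) auto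
  qed
  moreover have "\<exists>T. \<forall>x\<in>carrier ?X. \<psi> x = T"
    using const by blast
  ultimately show ?thesis
    unfolding Let_def Z_def U_def[abs_def] R_def[abs_def] \<rho>_def T_def by (intro conjI)
qed

end
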